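(* Let $V$ be the $\mathcal O_q$-module, with associated notation, described in the context. The maps $K,B,K^\downarrow,B^\downarrow\in\mathrm{End}(V)$ satisfy $$HB^{-1}H^{-1}=a^{-1}A-a^{-2}B,\qquad HK^{-1}H^{-1}=aA-a^2K,$$ $$H(B^\downarrow)^{-1}H^{-1}=a^{-1}A-a^{-2}B^\downarrow,\qquad H(K^\downarrow)^{-1}H^{-1}=aA-a^2K^\downarrow.$$
   Context: Setting. $\mathbb F$ is a field and $q\in\mathbb F$ is nonzero and not a root of unity. Algebras are associative, unital, over $\mathbb F$. Write $[X,Y]=XY-YX$, $[X,Y]_q=qXY-q^{-1}YX$, $[X,Y]_{q^{-1}}=q^{-1}XY-qYX$. The $q$-Onsager algebra $\mathcal O_q$ is defined by generators $A,A^*$ and relations $[A,[A,[A,A^*]_q]_{q^{-1}}]=(q^2-q^{-2})^2[A^*,A]$ and $[A^*,[A^*,[A^*,A]_q]_{q^{-1}}]=(q^2-q^{-2})^2[A,A^*]$. $V$ is an irreducible $\mathcal O_q$-module of finite dimension at least $2$ on which each of $A,A^*$ is diagonalizable; elements of $\mathcal O_q$ are identified with their actions on $V$. Eigenspaces. The eigenvalues of $A$ on $V$ can be ordered as mutually distinct $\theta_0,\dots,\theta_d$ ($d\ge 1$) such that $\theta_i=aq^{d-2i}+a^{-1}q^{2i-d}$ ($0\le i\le d$) for some nonzero $a\in\mathbb F$; fix such an ordering and $a$. $V_i$ is the $\theta_i$-eigenspace of $A$ and $E_i\in\mathrm{End}(V)$ is the projection onto $V_i$ along $\bigoplus_{j\ne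 i}V_j$; one has $A^*V_i\subseteq V_{i-1}+V_i+V_{i+1}$ ($V_{-1}=V_{d+1}=0$). $A^*$ also has exactly $d+1$ eigenspaces on $V$, and they can be ordered $V^*_0,\dots,V^*_d$ so that $AV^*_i\subseteq V^*_{i-1}+V^*_i+V^*_{i+1}$ ($V^*_{-1}=V^*_{d+1}=0$); fix such an ordering. The map $H$. Let $t_{ij}=1+\frac{\theta_i-\theta_j}{q-q^{-1}}\cdot\frac{q\theta_i-q^{-1}\theta_j}{q^2-q^{-2}}$, $t_i=t_{01}t_{12}\cdots t_{i-1,i}$ ($t_0=1$), and $H=\sum_{i=0}^d t_iE_i\in\mathrm{End}(V)$; each $t_i\neq0$, so $H$ is invertible. Maps. A decomposition of $V$ is a sequence $\{W_i\}_{i=0}^d$ of nonzero subspaces with direct sum $V$; its corresponding map is the element of $\mathrm{End}(V)$ acting on $W_i$ as $q^{d-2i}$ times the identity ($0\le i\le d$). $K,B,K^\downarrow,B^\downarrow$ are the maps corresponding to the decompositions $\{W_i\}_{i=0}^d$ (each known to be a decomposition) given respectively by: $K$: $W_i=(V^*_0+\cdots+V^*_i)\cap(V_i+\cdots+V_d)$; $B$: $W_i=(V^*_0+\cdots+V^*_i)\cap(V_0+\cdots+V_{d-i})$; $K^\downarrow$: $W_i=(V^*_{d-i}+\cdots+V^*_d)\cap(V_i+\cdots+V_d)$; $B^\downarrow$: $W_i=(V^*_{d-i}+\cdots+V^*_d)\cap(V_0+\cdots+V_{d-i})$. It is known that each such $\{W_i\}$ has partial sums $W_0+\cdots+W_i$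 equal to the first of the two intersected subspaces and $W_i+\cdots+W_d$ equal to the second. *)

theory Defs
  imports Complex_Main "HOL-Library.Poly_Mapping" "HOL-Algebra.QuotRing"
begin

section \<open>The \<open>q\<close>-Onsager algebra\<close>

text \<open>
  The free algebra on \<open>A, A\<^sup>*\<close> is the monoid algebra of the free monoid of words in
  these letters. Words are wrapped in a datatype, with the empty word as \<open>0\<close> and concatenation as
  \<open>+\<close>, because the product of \<^typ>\<open>'a \<Rightarrow>\<^sub>0 'b\<close> is convolution over an additive monoid of exponents.
\<close>

datatype onsager_gen = Gen_A | Gen_Astar

datatype onsager_word = Word "onsager_gen list"

instantiation onsager_word :: monoid_add
begin

definition zero_onsager_word :: onsager_word where
  "0 = Word []"

fun plus_onsager_word :: "onsager_word \<Rightarrow> onsager_word \<Rightarrow> onsager_word" where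
  "Word u + Word v = Word (u @ v)"

instance
proof
  fix a b c :: onsager_word
  show "a + b + c = a + (b + c)" by (cases a; cases b; cases c) simp
  show "0 + a = a" by (cases a) (simp add: zero_onsager_word_def)
  show "a + 0 = a" by (cases a) (simp add: zero_onsager_word_def)
qed

end

type_synonym 'f free_alg = "onsager_word \<Rightarrow>\<^sub>0 'f"

definition free_alg_ring :: "'f::field free_alg ring" where
  "free_alg_ring =
     \<lparr>carrier = UNIV, monoid.mult = (\<lambda>x y. x * y), one = 1, ring.zero = 0, add = (\<lambda>x y. x + y)\<rparr>"

lemma ring_free_alg_ring: "ring (free_alg_ring :: 'f::field free_alg ring)"
proof -
  have "\<exists>y. x + y = 0" for x :: "'f free_alg"
    using add.right_inverse by blast
  then show ?thesis
    unfolding free_alg_ring_def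
    by unfold_locales (auto simp: algebra_simps Units_def)
qed

definition fa_gen :: "onsager_gen \<Rightarrow> 'f::field free_alg" where
  "fa_gen g = Poly_Mapping.single (Word [g]) 1"

definition fa_scalar :: "'f::field \<Rightarrow> 'f free_alg" where
  "fa_scalar c = Poly_Mapping.single 0 c"

definition fa_comm :: "'f::field free_alg \<Rightarrow> 'f free_alg \<Rightarrow> 'f free_alg" where
  "fa_comm X Y = X * Y - Y * X"

text \<open>\<open>[X, Y]\<^sub>q\<close>; the bracket \<open>[X, Y]\<close> with index \<open>q\<^sup>-\<^sup>1\<close> is obtained by putting \<open>inverse q\<close> for \<open>q\<close>.\<close>

definition fa_qcomm :: "'f::field \<Rightarrow> 'f free_alg \<Rightarrow> 'f free_alg \<Rightarrow> 'f free_alg" where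
  "fa_qcomm q X Y = fa_scalar q * (X * Y) - fa_scalar (inverse q) * (Y * X)"

definition onsager_relator :: "'f::field \<Rightarrow> 'f free_alg \<Rightarrow> 'f free_alg \<Rightarrow> 'f free_alg" where
  "onsager_relator q X Y =
     fa_comm X (fa_qcomm (inverse q) X (fa_qcomm q X Y))
     - fa_scalar ((q^2 - (inverse q)^2)^2) * fa_comm Y X"

definition onsager_ideal :: "'f::field \<Rightarrow> 'f free_alg set" where
  "onsager_ideal q =
     genideal free_alg_ring
       {onsager_relator q (fa_gen Gen_A) (fa_gen Gen_Astar),
        onsager_relator q (fa_gen Gen_Astar) (fa_gen Gen_A)}"

definition onsager_algebra :: "'f::field \<Rightarrow> 'f free_alg set ring" where
  "onsager_algebra q = free_alg_ring Quot onsager_ideal q"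

definition oq_class :: "'f::field \<Rightarrow> 'f free_alg \<Rightarrow> 'f free_alg set" where
  "oq_class q x = onsager_ideal q +>\<^bsub>free_alg_ring\<^esub> x"

section \<open>Modules\<close>

text \<open>The vector space \<open>V\<close> is the whole type \<^typ>\<open>'v\<close>, with scalar multiplication \<open>scale\<close>.\<close>

definition oq_module ::
  "'f::field \<Rightarrow> ('f \<Rightarrow> 'v::ab_group_add \<Rightarrow> 'v) \<Rightarrow> ('f free_alg set \<Rightarrow> 'v \<Rightarrow> 'v) \<Rightarrow> bool" where
  "oq_module q scale act \<longleftrightarrow>
     vector_space scale \<and>
     (\<forall>x \<in> carrier (onsager_algebra q). Vector_Spaces.linear scale scale (act x)) \<and>
     (\<forall>x \<in> carrier (onsager_algebra q). \<forall>y \<in> carrier (onsager_algebra q). \<forall>v.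
        act (x \<oplus>\<^bsub>onsager_algebra q\<^esub> y) v = act x v + act y v) \<and>
     (\<forall>x \<in> carrier (onsager_algebra q). \<forall>y \<in> carrier (onsager_algebra q). \<forall>v.
        act (x \<otimes>\<^bsub>onsager_algebra q\<^esub> y) v = act x (act y v)) \<and>
     (\<forall>v. act \<one>\<^bsub>onsager_algebra q\<^esub> v = v) \<and>
     (\<forall>c v. act (oq_class q (fa_scalar c)) v = scale c v)"

definition irreducible_oq_module ::
  "'f::field \<Rightarrow> ('f \<Rightarrow> 'v::ab_group_add \<Rightarrow> 'v) \<Rightarrow> ('f free_alg set \<Rightarrow> 'v \<Rightarrow> 'v) \<Rightarrow> bool" where
  "irreducible_oq_module q scale act \<longleftrightarrow>
     oq_module q scale act \<and> (\<exists>v::'v. v \<noteq> 0) \<and>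
     (\<forall>U. module.subspace scale U \<and>
          (\<forall>x \<in> carrier (onsager_algebra q). act x ` U \<subseteq> U) \<longrightarrow> U = {0} \<or> U = UNIV)"

section \<open>Eigenspaces and decompositions\<close>

definition eigenspace :: "('f \<Rightarrow> 'v \<Rightarrow> 'v) \<Rightarrow> ('v \<Rightarrow> 'v) \<Rightarrow> 'f \<Rightarrow> 'v set" where
  "eigenspace scale T c = {v. T v = scale c v}"

definition eigenvalues :: "('f \<Rightarrow> 'v::zero \<Rightarrow> 'v) \<Rightarrow> ('v \<Rightarrow> 'v) \<Rightarrow> 'f set" where
  "eigenvalues scale T = {c. \<exists>v. v \<noteq> 0 \<and> T v = scale c v}"

definition diagonalizable :: "('f::field \<Rightarrow> 'v::ab_group_add \<Rightarrow> 'v) \<Rightarrow> ('v \<Rightarrow> 'v) \<Rightarrow> bool" where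
  "diagonalizable scale T \<longleftrightarrow>
     (\<exists>S. \<not> module.dependent scale S \<and> module.span scale S = UNIV \<and>
          (\<forall>b\<in>S. \<exists>c. T b = scale c b))"

definition subspace_sum ::
  "('f::field \<Rightarrow> 'v::ab_group_add \<Rightarrow> 'v) \<Rightarrow> nat set \<Rightarrow> (nat \<Rightarrow> 'v set) \<Rightarrow> 'v set" where
  "subspace_sum scale J W = module.span scale (\<Union>j\<in>J. W j)"

text \<open>\<open>T W\<^sub>i \<subseteq> W\<^sub>i\<^sub>-\<^sub>1 + W\<^sub>i + W\<^sub>i\<^sub>+\<^sub>1\<close> for \<open>i \<le> d\<close>, out-of-range summands being \<open>0\<close>.\<close>

definition acts_tridiagonally ::
  "('f::field \<Rightarrow> 'v::ab_group_add \<Rightarrow> 'v) \<Rightarrow> nat \<Rightarrow> ('v \<Rightarrow> 'v) \<Rightarrow> (nat \<Rightarrow> 'v set) \<Rightarrow> bool" where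
  "acts_tridiagonally scale d T W \<longleftrightarrow>
     (\<forall>i\<le>d. T ` W i \<subseteq> subspace_sum scale {j. j \<le> d \<and> j \<le> i + 1 \<and> i \<le> j + 1} W)"

text \<open>The projection onto \<open>U\<close> along \<open>U'\<close>, for \<open>V\<close> the direct sum of \<open>U\<close> and \<open>U'\<close>.\<close>

definition proj_along :: "'v::ab_group_add set \<Rightarrow> 'v set \<Rightarrow> 'v \<Rightarrow> 'v" where
  "proj_along U U' v = (THE u. u \<in> U \<and> v - u \<in> U')"

definition decomposition ::
  "('f::field \<Rightarrow> 'v::ab_group_add \<Rightarrow> 'v) \<Rightarrow> nat \<Rightarrow> (nat \<Rightarrow> 'v set) \<Rightarrow> bool" where
  "decomposition scale d W \<longleftrightarrow>
     (\<forall>i\<le>d. module.subspace scale (W i) \<and> W i \<noteq> {0}) \<and>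
     subspace_sum scale {..d} W = UNIV \<and>
     (\<forall>w. (\<forall>i\<le>d. w i \<in> W i) \<and> (\<Sum>i\<le>d. w i) = 0 \<longrightarrow> (\<forall>i\<le>d. w i = 0))"

definition corresponding_map ::
  "('f::field \<Rightarrow> 'v::ab_group_add \<Rightarrow> 'v) \<Rightarrow> 'f \<Rightarrow> nat \<Rightarrow> (nat \<Rightarrow> 'v set) \<Rightarrow> 'v \<Rightarrow> 'v" where
  "corresponding_map scale q d W =
     (THE T. Vector_Spaces.linear scale scale T \<and>
             (\<forall>i\<le>d. \<forall>w\<in>W i. T w = scale (q powi (int d - 2 * int i)) w))"

text \<open>For a decomposition, the description in \<open>corresponding_map\<close> is a definite one.\<close>

lemma corresponding_map_ex1:
  fixes scale :: "'f::field \<Rightarrow> 'v::ab_group_add \<Rightarrow> 'v"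
  assumes vs: "vector_space scale" and dec: "decomposition scale d W"
  shows "\<exists>!T. Vector_Spaces.linear scale scale T \<and> (\<forall>i\<le>d. \<forall>w\<in>W i. T w = scale (c i) w)"
proof -
  interpret vector_space scale by (rule vs)
  have sub: "subspace (W i)" if "i \<le> d" for i
    using dec that by (simp add: decomposition_def)
  have ind: "\<forall>i\<le>d. w i = 0" if "\<forall>i\<le>d. w i \<in> W i" "(\<Sum>i\<le>d. w i) = 0" for w
    using dec that unfolding decomposition_def by blast
  define P where "P v w \<longleftrightarrow> (\<forall>i. w i \<in> (if i \<le> d then W i else {0})) \<and> (\<Sum>i\<le>d. w i) = v" for v w
  have ex: "\<exists>w. P v w" for v
  proof -
    have "subspace {v. \<exists>w. P v w}"
    proof (rule subspaceI)
      show "0 \<in> {v. \<exists>w. P v w}"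
        unfolding P_def using sub subspace_0 by (auto intro!: exI[of _ "\<lambda>_. 0"])
    next
      fix x y assume "x \<in> {v. \<exists>w. P v w}" "y \<in> {v. \<exists>w. P v w}"
      then obtain w w' where "P x w" "P y w'" by blast
      then have "P (x + y) (\<lambda>i. w i + w' i)"
        unfolding P_def using sub subspace_add by (auto simp: sum.distrib split: if_splits)
      then show "x + y \<in> {v. \<exists>w. P v w}" by blast
    next
      fix k x assume "x \<in> {v. \<exists>w. P v w}"
      then obtain w where "P x w" by blast
      then have "P (scale k x) (\<lambda>i. scale k (w i))"
        unfolding P_def using sub subspace_scale by (auto simp: scale_sum_right split: if_splits)
      then show "scale k x \<in> {v. \<exists>w. P v w}" by blast
    qed
    moreover have "(\<Union>j\<in>{..d}. W j) \<subseteq> {v. \<exists>w. P v w}"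
    proof
      fix x assume "x \<in> (\<Union>j\<in>{..d}. W j)"
      then obtain j where j: "j \<le> d" "x \<in> W j" by auto
      have "P x (\<lambda>i. if i = j then x else 0)"
        unfolding P_def using j sub subspace_0 by auto
      then show "x \<in> {v. \<exists>w. P v w}" by blast
    qed
    ultimately have "span (\<Union>j\<in>{..d}. W j) \<subseteq> {v. \<exists>w. P v w}"
      by (rule span_minimal[rotated])
    then show ?thesis
      using dec by (auto simp: decomposition_def subspace_sum_def)
  qed
  have uniq: "w = w'" if "P v w" "P v w'" for v w w'
  proof -
    have "\<forall>i\<le>d. w i - w' i = 0"
    proof (rule ind)
      show "\<forall>i\<le>d. w i - w' i \<in> W i"
        using that sub subspace_diff unfolding P_def by (metis (full_types))
      show "(\<Sum>i\<le>d. w i - w' i) = 0"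
        using that by (simp add: P_def sum_subtractf)
    qed
    moreover have "w i = w' i" if "\<not> i \<le> d" for i
      using \<open>P v w\<close> \<open>P v w'\<close> that unfolding P_def by (metis singletonD)
    ultimately show ?thesis by (metis eq_iff_diff_eq_0 ext)
  qed
  define comp where "comp v = (SOME w. P v w)" for v
  have comp: "P v (comp v)" for v
    unfolding comp_def using ex by (rule someI_ex)
  have compI: "comp v = w" if "P v w" for v w
    using uniq comp that by blast
  define T0 where "T0 v = (\<Sum>i\<le>d. scale (c i) (comp v i))" for v
  have cadd: "comp (x + y) = (\<lambda>i. comp x i + comp y i)" for x y
    by (rule compI) (use comp[of x] comp[of y] sub subspace_add in \<open>auto simp: P_def sum.distrib split: if_splits\<close>)
  have cscale: "comp (scale k x) = (\<lambda>i. scale k (comp x i))" for k x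
    by (rule compI) (use comp[of x] sub subspace_scale in \<open>auto simp: P_def scale_sum_right[symmetric] split: if_splits\<close>)
  have lin0: "Vector_Spaces.linear scale scale T0"
    by unfold_locales
      (auto simp: T0_def cadd cscale sum.distrib scale_right_distrib scale_sum_right mult.commute)
  have act0: "T0 w = scale (c j) w" if "j \<le> d" "w \<in> W j" for j w
  proof -
    have "comp w = (\<lambda>i. if i = j then w else 0)"
      by (rule compI) (use that sub subspace_0 in \<open>auto simp: P_def\<close>)
    then have "T0 w = (\<Sum>i\<le>d. if i = j then scale (c i) w else 0)"
      unfolding T0_def by (intro sum.cong) auto
    then show ?thesis using that by simp
  qed
  show ?thesis
  proof (rule ex1I[of _ T0])
    show "Vector_Spaces.linear scale scale T0 \<and> (\<forall>i\<le>d. \<forall>w\<in>W i. T0 w = scale (c i) w)"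
      using lin0 act0 by blast
  next
    fix T assume T: "Vector_Spaces.linear scale scale T \<and> (\<forall>i\<le>d. \<forall>w\<in>W i. T w = scale (c i) w)"
    then interpret T: Vector_Spaces.linear scale scale T by blast
    show "T = T0"
    proof
      fix v
      have mem: "\<forall>i\<le>d. comp v i \<in> W i" and v: "v = (\<Sum>i\<le>d. comp v i)"
        using comp[of v] by (auto simp: P_def split: if_splits)
      have "T v = (\<Sum>i\<le>d. T (comp v i))"
        by (subst v) (rule T.sum)
      also have "\<dots> = T0 v"
        unfolding T0_def using T mem by (intro sum.cong) auto
      finally show "T v = T0 v" .
    qed
  qed
qed

section \<open>The map \<open>H\<close>\<close>

definition t_pair :: "'f::field \<Rightarrow> (nat \<Rightarrow> 'f) \<Rightarrow> nat \<Rightarrow> nat \<Rightarrow> 'f" where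
  "t_pair q \<theta> i j =
     1 + (\<theta> i - \<theta> j) / (q - inverse q) * ((q * \<theta> i - inverse q * \<theta> j) / (q^2 - (inverse q)^2))"

definition t_coeff :: "'f::field \<Rightarrow> (nat \<Rightarrow> 'f) \<Rightarrow> nat \<Rightarrow> 'f" where
  "t_coeff q \<theta> i = (\<Prod>k<i. t_pair q \<theta> k (k + 1))"

definition E_proj ::
  "('f::field \<Rightarrow> 'v::ab_group_add \<Rightarrow> 'v) \<Rightarrow> nat \<Rightarrow> (nat \<Rightarrow> 'v set) \<Rightarrow> nat \<Rightarrow> 'v \<Rightarrow> 'v" where
  "E_proj scale d V i = proj_along (V i) (subspace_sum scale ({..d} - {i}) V)"

definition H_map ::
  "('f::field \<Rightarrow> 'v::ab_group_add \<Rightarrow> 'v) \<Rightarrow> 'f \<Rightarrow> nat \<Rightarrow> (nat \<Rightarrow> 'f) \<Rightarrow> (nat \<Rightarrow> 'v set) \<Rightarrow> 'v \<Rightarrow> 'v" where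
  "H_map scale q d \<theta> V v = (\<Sum>i\<le>d. scale (t_coeff q \<theta> i) (E_proj scale d V i v))"

end

theory Submission
  imports Defs
begin

text \<open>
  All four identities are instances of one. Inverting the ordering of the \<open>V i\<close> replaces \<open>a\<close> by
  \<open>a\<^sup>-\<^sup>1\<close> and \<open>K\<close> by \<open>B\<close>; inverting the ordering of the \<open>Vstar i\<close> replaces \<open>K\<close>, \<open>B\<close> by
  \<open>Kd\<close>, \<open>Bd\<close>. So consider \<open>K\<close>.

  The subspaces \<open>U n\<close> of the decomposition of \<open>K\<close> satisfy \<open>(A - \<theta> n) U n \<subseteq> U (n + 1)\<close>, and the
  eigenvalue of \<open>K\<close> is divided by \<open>q\<^sup>2\<close> from each to the next. This gives a relation
  between \<open>K\<close> and \<open>A\<close> from which it follows that \<open>X = a\<^sup>-\<^sup>1 K\<^sup>-\<^sup>1\<close> and \<open>X = A - a K\<close> are both solutions of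
  \<open>q A X - q\<^sup>-\<^sup>1 X A = (q - q\<^sup>-\<^sup>1) (X\<^sup>2 + 1)\<close> (lemmas \<open>A_N_relation\<close>, \<open>A_N'_relation\<close>). As \<open>H\<close> commutes
  with \<open>A\<close>, the operator \<open>H a\<^sup>-\<^sup>1 K\<^sup>-\<^sup>1 H\<^sup>-\<^sup>1\<close> is a third solution, and it has to be equal to the second.

  Both are block triangular for the flag \<open>V n + \<dots> + V d\<close>, with the same diagonal blocks. The weights of
  \<open>H\<close> have exactly the ratios that make the blocks next to the diagonal agree (\<open>D_second_step\<close>). The
  equation determines all further blocks recursively, because the coefficient of the unknown block is a
  nonzero scalar (\<open>coefficient_nonzero\<close>, \<open>D_step\<close>); hence \<open>H a\<^sup>-\<^sup>1 K\<^sup>-\<^sup>1 = (A - a K) H\<close>, which is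
  \<open>H_conjugates_N\<close>.

  Two facts about the module have to be supplied. That the eigenspaces of \<open>A\<close> are moved by
  \<open>Astar\<close> at most to their neighbours follows from the first defining relation
  (\<open>acts_tridiagonally_of_relation\<close>). That the \<open>U n\<close> form a decomposition compatible with both flags is
  the theorem \<open>split_decomposition\<close> with \<open>F_subset\<close> and \<open>G_subset\<close>: certain spans of intersections of
  the flags are invariant, hence trivial by irreducibility.
\<close>

section \<open>Sums of subspaces and linear maps\<close>

lemma image_reflect:
  assumes "n \<le> (d::nat)"
  shows "(\<lambda>i. d - i) ` {n..d} = {..d - n}" "(\<lambda>i. d - i) ` {..n} = {d - n..d}"
proof -
  show "(\<lambda>i. d - i) ` {n..d} = {..d - n}"
  proof
    show "{..d - n} \<subseteq> (\<lambda>i. d - i) ` {n..d}"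
    proof
      fix k assume "k \<in> {..d - n}"
      then have "k = d - (d - k)" "d - k \<in> {n..d}" using assms by auto
      then show "k \<in> (\<lambda>i. d - i) ` {n..d}" by (rule image_eqI)
    qed
  qed auto
  show "(\<lambda>i. d - i) ` {..n} = {d - n..d}"
  proof
    show "{d - n..d} \<subseteq> (\<lambda>i. d - i) ` {..n}"
    proof
      fix k assume "k \<in> {d - n..d}"
      then have "k = d - (d - k)" "d - k \<in> {..n}" using assms by auto
      then show "k \<in> (\<lambda>i. d - i) ` {..n}" by (rule image_eqI)
    qed
  qed auto
qed

context vector_space
begin

interpretation endo: vector_space_pair scale scale ..

lemma subspace_subspace_sum: "subspace (subspace_sum scale J W)"
  by (simp add: subspace_sum_def)

lemma subspace_sum_upper: "j \<in> J \<Longrightarrow> v \<in> W j \<Longrightarrow> v \<in> subspace_sum scale J W"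
  unfolding subspace_sum_def by (rule span_base) blast

lemma subspace_sum_least:
  "subspace S \<Longrightarrow> (\<And>j. j \<in> J \<Longrightarrow> W j \<subseteq> S) \<Longrightarrow> subspace_sum scale J W \<subseteq> S"
  unfolding subspace_sum_def by (rule span_minimal) blast

lemma subspace_sum_mono: "J \<subseteq> J' \<Longrightarrow> subspace_sum scale J W \<subseteq> subspace_sum scale J' W"
  unfolding subspace_sum_def by (rule span_mono) blast

lemma subspace_sum_empty: "subspace_sum scale {} W = {0}"
  by (simp add: subspace_sum_def)

lemma subspace_sum_reindex:
  "subspace_sum scale J (\<lambda>i. W (f i)) = subspace_sum scale (f ` J) W"
  by (simp add: subspace_sum_def)

lemma subspace_sum_Un:
  assumes "v \<in> subspace_sum scale (J \<union> J') W"
  obtains x y where "x \<in> subspace_sum scale J W" "y \<in> subspace_sum scale J' W" "v = x + y"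
proof -
  have "v \<in> span ((\<Union>j\<in>J. W j) \<union> (\<Union>j\<in>J'. W j))"
    using assms by (simp add: subspace_sum_def)
  then show thesis
    unfolding span_Un using that by (auto simp: subspace_sum_def)
qed

lemma subspace_linear_vimage:
  assumes "Vector_Spaces.linear scale scale f" "subspace S"
  shows "subspace {v. f v \<in> S}"
  using endo.linear_subspace_vimage[OF assms] by (simp add: vimage_def)

lemma linear_subspace_sum_subset:
  assumes f: "Vector_Spaces.linear scale scale f" and S: "subspace S"
    and W: "\<And>j v. j \<in> J \<Longrightarrow> v \<in> W j \<Longrightarrow> f v \<in> S"
    and v: "v \<in> subspace_sum scale J W"
  shows "f v \<in> S"
  using subspace_sum_least[OF subspace_linear_vimage[OF f S], of J W] W v by blast

lemma linear_eq_on_subspace_sum: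
  assumes f: "Vector_Spaces.linear scale scale f" and g: "Vector_Spaces.linear scale scale g"
    and W: "\<And>j v. j \<in> J \<Longrightarrow> v \<in> W j \<Longrightarrow> f v = g v"
    and v: "v \<in> subspace_sum scale J W"
  shows "f v = g v"
  using endo.linear_eq_on_span[OF f g, of "\<Union>j\<in>J. W j"] W v
  by (auto simp: subspace_sum_def)

lemma linear_shift:
  assumes "Vector_Spaces.linear scale scale f"
  shows "Vector_Spaces.linear scale scale (\<lambda>v. f v - scale c v)"
  by (intro endo.linear_compose_sub assms linear_scale_self)

text \<open>The condition \<open>\<bar>i - j\<bar> \<le> 1\<close> is invariant under \<open>i \<mapsto> d - i\<close>. This is what lets one
  split decomposition serve for all four.\<close>

lemma acts_tridiagonally_rev:
  assumes "acts_tridiagonally scale d T W"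
  shows "acts_tridiagonally scale d T (\<lambda>i. W (d - i))"
  unfolding acts_tridiagonally_def
proof (intro allI impI)
  fix i assume i: "i \<le> d"
  have "(\<lambda>i. d - i) ` {j. j \<le> d \<and> j \<le> i + 1 \<and> i \<le> j + 1}
      = {j. j \<le> d \<and> j \<le> d - i + 1 \<and> d - i \<le> j + 1}" (is "?f ` ?J = ?J'")
  proof
    show "?f ` ?J \<subseteq> ?J'" using i by auto
    show "?J' \<subseteq> ?f ` ?J"
    proof
      fix k assume "k \<in> ?J'"
      then have "k = ?f (d - k)" "d - k \<in> ?J" using i by auto
      then show "k \<in> ?f ` ?J" by blast
    qed
  qed
  then show "T ` W (d - i) \<subseteq> subspace_sum scale {j. j \<le> d \<and> j \<le> i + 1 \<and> i \<le> j + 1} (\<lambda>i. W (d - i))"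
    using assms i unfolding subspace_sum_reindex acts_tridiagonally_def by simp
qed

text \<open>The operator is the product of the factors \<open>T - c i\<close> over \<open>i \<in> J\<close>. Being a polynomial in
  \<open>T\<close>, it acts on every eigenspace by a scalar, which vanishes exactly for the eigenvalues
  \<open>c i\<close>. So no nonzero eigenvector for another eigenvalue lies in
  the sum of the eigenspaces for the \<open>c i\<close>.\<close>

lemma eigenspace_separation:
  assumes T: "Vector_Spaces.linear scale scale T" and "finite J"
  shows "\<exists>S. Vector_Spaces.linear scale scale S
    \<and> (\<forall>i\<in>J. \<forall>v\<in>eigenspace scale T (c i). S v = 0)
    \<and> (\<forall>e. e \<notin> c ` J \<longrightarrow> (\<forall>v\<in>eigenspace scale T e. \<exists>k. k \<noteq> 0 \<and> S v = scale k v))"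
  using \<open>finite J\<close>
proof (induction J rule: finite_induct)
  case empty
  have "\<exists>k. k \<noteq> 0 \<and> v = scale k v" for v
    by (rule exI[of _ 1]) simp
  then show ?case
    by (intro exI[of _ "\<lambda>v. v"]) (simp add: linear_ident)
next
  case (insert j J)
  from insert.IH obtain S where *: "Vector_Spaces.linear scale scale S
    \<and> (\<forall>i\<in>J. \<forall>v\<in>eigenspace scale T (c i). S v = 0)
    \<and> (\<forall>e. e \<notin> c ` J \<longrightarrow> (\<forall>v\<in>eigenspace scale T e. \<exists>k. k \<noteq> 0 \<and> S v = scale k v))"
    by (rule exE)
  note S = conjunct1[OF *]
  note S0 = conjunct1[OF conjunct2[OF *], rule_format]
  note S1 = conjunct2[OF conjunct2[OF *], rule_format]
  have shift: "S (T v - scale (c j) v) = scale (e - c j) (S v)"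
    if "v \<in> eigenspace scale T e" for e v
    using that
    by (simp add: eigenspace_def scale_left_diff_distrib endo.linear_diff[OF S] endo.linear_scale[OF S])
  show ?case
  proof (rule exI, intro conjI ballI allI impI)
    show "Vector_Spaces.linear scale scale (\<lambda>v. S (T v - scale (c j) v))"
      using Vector_Spaces.linear_compose[OF linear_shift[OF T] S] by (simp add: o_def)
    show "S (T v - scale (c j) v) = 0" if "i \<in> insert j J" "v \<in> eigenspace scale T (c i)" for i v
      using that shift[OF that(2)] S0 by auto
    show "\<exists>k. k \<noteq> 0 \<and> S (T v - scale (c j) v) = scale k v"
      if e: "e \<notin> c ` insert j J" and v: "v \<in> eigenspace scale T e" for e v
    proof -
      have "e \<notin> c ` J" using e by auto
      from S1[OF this v] obtain k where k: "k \<noteq> 0" "S v = scale k v" by blast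
      show ?thesis
        using shift[OF v] k e by (auto intro!: exI[of _ "(e - c j) * k"])
    qed
  qed
qed

lemma eigenspace_disjoint_sum:
  assumes T: "Vector_Spaces.linear scale scale T" and J: "finite J" and e: "e \<notin> c ` J"
    and W: "\<And>j. j \<in> J \<Longrightarrow> W j = eigenspace scale T (c j)"
    and v: "v \<in> eigenspace scale T e" "v \<in> subspace_sum scale J W"
  shows "v = 0"
proof -
  obtain S where *: "Vector_Spaces.linear scale scale S
    \<and> (\<forall>i\<in>J. \<forall>v\<in>eigenspace scale T (c i). S v = 0)
    \<and> (\<forall>e. e \<notin> c ` J \<longrightarrow> (\<forall>v\<in>eigenspace scale T e. \<exists>k. k \<noteq> 0 \<and> S v = scale k v))"
    using eigenspace_separation[OF T J, of c] by (rule exE)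
  note S = conjunct1[OF *]
  note S0 = conjunct1[OF conjunct2[OF *], rule_format]
  have S1: "\<exists>k. k \<noteq> 0 \<and> S v = scale k v"
    using conjunct2[OF conjunct2[OF *], rule_format, OF e v(1)] .
  have "S v \<in> {0}"
    by (rule linear_subspace_sum_subset[OF S _ _ v(2)]) (use S0 W in auto)
  then show ?thesis using S1 by auto
qed

lemma eigenvector_sum_zero:
  fixes J :: "nat set"
  assumes T: "Vector_Spaces.linear scale scale T" and J: "finite J" "inj_on c J"
    and w: "\<And>j. j \<in> J \<Longrightarrow> w j \<in> eigenspace scale T (c j)"
    and sum: "(\<Sum>j\<in>J. w j) = 0" and j: "j \<in> J"
  shows "w j = 0"
proof (rule eigenspace_disjoint_sum[OF T, of "J - {j}" "c j" c "\<lambda>i. eigenspace scale T (c i)"])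
  show "c j \<notin> c ` (J - {j})" using J(2) j by (auto simp: inj_on_def)
  have "w j = - (\<Sum>i\<in>J - {j}. w i)"
    using sum J(1) j by (simp add: sum.remove eq_neg_iff_add_eq_0)
  moreover have "(\<Sum>i\<in>J - {j}. w i)
      \<in> subspace_sum scale (J - {j}) (\<lambda>i. eigenspace scale T (c i))"
    using w by (intro subspace_sum subspace_subspace_sum) (auto intro: subspace_sum_upper)
  ultimately show "w j \<in> subspace_sum scale (J - {j}) (\<lambda>i. eigenspace scale T (c i))"
    using subspace_neg[OF subspace_subspace_sum] by metis
qed (use J w j in auto)

lemma subspace_sum_components:
  assumes "finite J" "\<And>j. j \<in> J \<Longrightarrow> subspace (W j)" "v \<in> subspace_sum scale J W"
  shows "\<exists>w. (\<forall>j\<in>J. w j \<in> W j) \<and> v = (\<Sum>j\<in>J. w j)"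
  using assms
proof (induction J arbitrary: v rule: finite_induct)
  case empty
  then show ?case by (simp add: subspace_sum_empty)
next
  case (insert j J)
  have "v \<in> subspace_sum scale ({j} \<union> J) W" using insert.prems(2) by simp
  then obtain x z where xz: "x \<in> subspace_sum scale {j} W" "z \<in> subspace_sum scale J W" "v = x + z"
    by (rule subspace_sum_Un)
  have "x \<in> W j"
    using xz(1) span_eq_iff[THEN iffD2, OF insert.prems(1)[of j]] by (simp add: subspace_sum_def)
  moreover obtain w where "\<forall>i\<in>J. w i \<in> W i" "z = (\<Sum>i\<in>J. w i)"
    using insert.IH[OF _ xz(2)] insert.prems(1) by auto
  moreover have "(\<Sum>i\<in>J. w i) = (\<Sum>i\<in>J. (w(j := x)) i)"
    using insert.hyps by (intro sum.cong) auto
  ultimately show ?case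
    using insert.hyps xz(3) by (intro exI[of _ "w(j := x)"]) auto
qed

lemma subspace_eigenspace:
  assumes "Vector_Spaces.linear scale scale T"
  shows "subspace (eigenspace scale T c)"
  using subspace_linear_vimage[OF linear_shift[OF assms, of c], of "{0}"]
  by (simp add: eigenspace_def)

lemma proj_along_eq:
  assumes "subspace U" "subspace U'" "U \<inter> U' = {0}" "u \<in> U" "v - u \<in> U'"
  shows "proj_along U U' v = u"
  unfolding proj_along_def
proof (rule the_equality)
  fix w assume w: "w \<in> U \<and> v - w \<in> U'"
  have "w - u \<in> U" using w assms by (simp add: subspace_diff)
  moreover have "w - u \<in> U'"
    using subspace_diff[OF assms(2) assms(5), of "v - w"] w by simp
  ultimately have "w - u = 0" using assms(3) by blast
  then show "w = u" by simp
qed (use assms in simp)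

lemma linear_proj_along:
  assumes U: "subspace U" "subspace U'" "U \<inter> U' = {0}" and sum: "\<And>v. \<exists>u\<in>U. v - u \<in> U'"
  shows "Vector_Spaces.linear scale scale (proj_along U U')"
proof -
  define p where "p = proj_along U U'"
  have p: "p v \<in> U" "v - p v \<in> U'" for v
    using sum[of v] proj_along_eq[OF U] unfolding p_def by auto
  have eq: "p v = u" if "u \<in> U" "v - u \<in> U'" for u v
    unfolding p_def by (rule proj_along_eq[OF U that])
  have "p (x + y) = p x + p y" for x y
    by (rule eq)
      (use p U subspace_add[OF U(2) p(2)[of x] p(2)[of y]] in \<open>simp_all add: subspace_add algebra_simps\<close>)
  moreover have "p (scale k x) = scale k (p x)" for k x
    by (rule eq)
      (use p U subspace_scale[OF U(2) p(2)[of x], of k] in \<open>simp_all add: subspace_scale scale_right_diff_distrib\<close>)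
  ultimately show ?thesis
    unfolding p_def[symmetric] by unfold_locales auto
qed

end

section \<open>The split decomposition of a tridiagonal pair\<close>

text \<open>A tridiagonal pair in the sense of Ito, Tanabe and Terwilliger, with an ordering of the
  eigenspaces chosen on each side. The conditions are preserved when either ordering is
  inverted.\<close>

locale tridiagonal_pair = vector_space scale
  for scale :: "'f::field \<Rightarrow> 'v::ab_group_add \<Rightarrow> 'v" +
  fixes d :: nat and A Astar :: "'v \<Rightarrow> 'v" and \<theta> \<theta>s :: "nat \<Rightarrow> 'f" and V Vs :: "nat \<Rightarrow> 'v set"
  assumes lin_A: "Vector_Spaces.linear scale scale A"
    and lin_Astar: "Vector_Spaces.linear scale scale Astar"
    and V_eigenspace: "i \<le> d \<Longrightarrow> V i = eigenspace scale A (\<theta> i)"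
    and Vs_eigenspace: "i \<le> d \<Longrightarrow> Vs i = eigenspace scale Astar (\<theta>s i)"
    and inj_\<theta>: "inj_on \<theta> {..d}" and inj_\<theta>s: "inj_on \<theta>s {..d}"
    and V_nonzero: "i \<le> d \<Longrightarrow> V i \<noteq> {0}" and Vs_nonzero: "i \<le> d \<Longrightarrow> Vs i \<noteq> {0}"
    and V_sum: "subspace_sum scale {..d} V = UNIV"
    and Vs_sum: "subspace_sum scale {..d} Vs = UNIV"
    and Astar_tridiagonal: "acts_tridiagonally scale d Astar V"
    and A_tridiagonal: "acts_tridiagonally scale d A Vs"
    and irreducible: "subspace U \<Longrightarrow> (\<And>v. v \<in> U \<Longrightarrow> A v \<in> U) \<Longrightarrow> (\<And>v. v \<in> U \<Longrightarrow> Astar v \<in> U)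
      \<Longrightarrow> U = {0} \<or> U = UNIV"
begin

interpretation endo: vector_space_pair scale scale ..

text \<open>The decompositions of \<open>K\<close>, \<open>B\<close>, \<open>Kd\<close>, \<open>Bd\<close> differ only in which of the two
  orderings are inverted, so the results below on \<open>U\<close> apply to all four.\<close>

lemma reverse_V: "tridiagonal_pair scale d A Astar (\<lambda>i. \<theta> (d - i)) \<theta>s (\<lambda>i. V (d - i)) Vs"
proof -
  have img: "(\<lambda>i. d - i) ` {..d} = {..d}"
    using image_reflect(2)[of d d] by (simp add: atMost_atLeast0)
  have "inj_on (\<lambda>i. \<theta> (d - i)) {..d}"
    unfolding inj_on_def
  proof (intro ballI impI)
    fix i j assume "i \<in> {..d}" "j \<in> {..d}" "\<theta> (d - i) = \<theta> (d - j)"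
    moreover from this have "d - i = d - j" by (intro inj_onD[OF inj_\<theta>]) auto
    ultimately show "i = j" by simp
  qed
  moreover have "subspace_sum scale {..d} (\<lambda>i. V (d - i)) = UNIV"
    unfolding subspace_sum_reindex img by (rule V_sum)
  moreover have "V (d - i) = eigenspace scale A (\<theta> (d - i))" "V (d - i) \<noteq> {0}" for i
    by (intro V_eigenspace V_nonzero; simp)+
  ultimately show ?thesis
    by (intro tridiagonal_pair.intro tridiagonal_pair_axioms.intro vector_space_axioms lin_A lin_Astar
        Vs_eigenspace inj_\<theta>s Vs_nonzero Vs_sum acts_tridiagonally_rev Astar_tridiagonal
        A_tridiagonal irreducible)
qed

lemma swap: "tridiagonal_pair scale d Astar A \<theta>s \<theta> Vs V"
  by (intro tridiagonal_pair.intro tridiagonal_pair_axioms.intro vector_space_axioms lin_A lin_Astar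
      V_eigenspace Vs_eigenspace inj_\<theta> inj_\<theta>s V_nonzero Vs_nonzero V_sum Vs_sum Astar_tridiagonal
      A_tridiagonal irreducible)

lemma reverse_Vs: "tridiagonal_pair scale d A Astar \<theta> (\<lambda>i. \<theta>s (d - i)) V (\<lambda>i. Vs (d - i))"
  by (rule tridiagonal_pair.swap[OF tridiagonal_pair.reverse_V[OF swap]])

text \<open>The flags \<open>F\<close> (ascending from \<open>{0}\<close>) and \<open>G\<close> (descending from the whole space) are
  indexed so that \<open>F n\<close> has \<open>n\<close> summands and \<open>G n\<close> omits \<open>n\<close> summands. The subspaces
  \<open>U n\<close> form the split decomposition; they are spelled out with eigenspaces, and not as
  \<open>F (Suc n) \<inter> G n\<close>, to match the description of the decomposition of \<open>K\<close> literally.\<close>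

definition F :: "nat \<Rightarrow> 'v set" where "F n = subspace_sum scale {..<n} Vs"
definition G :: "nat \<Rightarrow> 'v set" where "G n = subspace_sum scale {n..d} V"
definition U :: "nat \<Rightarrow> 'v set" where "U n = subspace_sum scale {..n} Vs \<inter> subspace_sum scale {n..d} V"

lemma U_eq: "U n = F (Suc n) \<inter> G n"
  by (simp add: U_def F_def G_def lessThan_Suc_atMost)

lemma subspace_F [simp]: "subspace (F n)" and subspace_G [simp]: "subspace (G n)"
  and subspace_U [simp]: "subspace (U n)"
  by (simp_all add: F_def G_def U_def subspace_subspace_sum subspace_inter)

lemma F_0: "F 0 = {0}" and G_beyond: "d < n \<Longrightarrow> G n = {0}"
  by (simp_all add: F_def G_def subspace_sum_empty)

lemma F_mono: "m \<le> n \<Longrightarrow> F m \<subseteq> F n" and G_antimono: "m \<le> n \<Longrightarrow> G n \<subseteq> G m"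
  unfolding F_def G_def by (intro subspace_sum_mono; auto)+

lemma A_on_V: "i \<le> d \<Longrightarrow> v \<in> V i \<Longrightarrow> A v = scale (\<theta> i) v"
  and Astar_on_Vs: "i \<le> d \<Longrightarrow> v \<in> Vs i \<Longrightarrow> Astar v = scale (\<theta>s i) v"
  by (simp_all add: V_eigenspace Vs_eigenspace eigenspace_def)

lemma V_subset_G: "n \<le> i \<Longrightarrow> i \<le> d \<Longrightarrow> V i \<subseteq> G n"
  unfolding G_def using subspace_sum_upper by fastforce

text \<open>An operator that is scalar on each \<open>V j\<close> is triangular for the flag \<open>G\<close>; modulo
  \<open>G (Suc n)\<close> it is \<open>c n\<close> on \<open>G n\<close>. It is used for \<open>A\<close> and for \<open>H\<close>.\<close>

lemma V_scalars_shift_G: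
  assumes f: "Vector_Spaces.linear scale scale f"
    and f_V: "\<And>j w. j \<le> d \<Longrightarrow> w \<in> V j \<Longrightarrow> f w = scale (c j) w"
    and n: "n \<le> d" and v: "v \<in> G n"
  shows "f v - scale (c n) v \<in> G (Suc n)"
proof (rule linear_subspace_sum_subset[OF linear_shift[OF f]])
  show "v \<in> subspace_sum scale {n..d} V" using v by (simp add: G_def)
  fix j w assume j: "j \<in> {n..d}" and w: "w \<in> V j"
  show "f w - scale (c n) w \<in> G (Suc n)"
  proof (cases "j = n")
    case True
    then show ?thesis using f_V j w subspace_0[OF subspace_G] by simp
  next
    case False
    then have "w \<in> G (Suc n)" using V_subset_G[of "Suc n" j] j w by auto
    then show ?thesis
      using f_V[of j w] j w by (simp add: subspace_diff subspace_scale)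
  qed
qed simp

lemma A_shift_G: "n \<le> d \<Longrightarrow> v \<in> G n \<Longrightarrow> A v - scale (\<theta> n) v \<in> G (Suc n)"
  by (rule V_scalars_shift_G[OF lin_A A_on_V])

lemma Astar_G:
  assumes "v \<in> G n"
  shows "Astar v \<in> G (n - 1)"
proof (rule linear_subspace_sum_subset[OF lin_Astar])
  show "v \<in> subspace_sum scale {n..d} V" using assms by (simp add: G_def)
  fix j w assume j: "j \<in> {n..d}" and w: "w \<in> V j"
  have "Astar w \<in> subspace_sum scale {k. k \<le> d \<and> k \<le> j + 1 \<and> j \<le> k + 1} V"
    using Astar_tridiagonal j w unfolding acts_tridiagonally_def by auto
  also have "\<dots> \<subseteq> G (n - 1)"
    unfolding G_def using j by (intro subspace_sum_mono) auto
  finally show "Astar w \<in> G (n - 1)" .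
qed simp

lemma A_F:
  assumes "v \<in> F n"
  shows "A v \<in> F (Suc n)"
proof (cases "n \<le> d")
  case True
  show ?thesis
  proof (rule linear_subspace_sum_subset[OF lin_A])
    show "v \<in> subspace_sum scale {..<n} Vs" using assms by (simp add: F_def)
    fix j w assume j: "j \<in> {..<n}" and w: "w \<in> Vs j"
    have "A w \<in> subspace_sum scale {k. k \<le> d \<and> k \<le> j + 1 \<and> j \<le> k + 1} Vs"
      using A_tridiagonal[unfolded acts_tridiagonally_def, rule_format, of j] True j w by auto
    also have "\<dots> \<subseteq> F (Suc n)"
      unfolding F_def using j by (intro subspace_sum_mono) auto
    finally show "A w \<in> F (Suc n)" .
  qed simp
next
  case False
  then have "subspace_sum scale {..d} Vs \<subseteq> F (Suc n)"
    unfolding F_def by (intro subspace_sum_mono) auto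
  then show ?thesis using Vs_sum by auto
qed

lemma Astar_shift_F:
  assumes "n \<le> d" "v \<in> F (Suc n)"
  shows "Astar v - scale (\<theta>s n) v \<in> F n"
proof (rule linear_subspace_sum_subset[OF linear_shift[OF lin_Astar]])
  show "v \<in> subspace_sum scale {..<Suc n} Vs" using assms by (simp add: F_def)
  fix j w assume j: "j \<in> {..<Suc n}" and w: "w \<in> Vs j"
  show "Astar w - scale (\<theta>s n) w \<in> F n"
  proof (cases "j = n")
    case True
    then show ?thesis using Astar_on_Vs assms(1) j w subspace_0[OF subspace_F] by simp
  next
    case False
    then have "w \<in> F n" unfolding F_def using subspace_sum_upper j w by (auto simp: less_Suc_eq)
    then show ?thesis
      using Astar_on_Vs[of j w] assms(1) j w by (simp add: subspace_diff subspace_scale)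
  qed
qed simp

text \<open>\<open>A - \<theta> (n + r)\<close> moves the \<open>n\<close>-th summand to its successor and
  \<open>Astar - \<theta>s n\<close> moves it to its predecessor, so the span is invariant and irreducibility
  decides it. The case \<open>r = 1\<close> gives \<open>{0}\<close>, since the span lies in the proper subspace \<open>G 1\<close>; the case
  \<open>r = 0\<close> gives the whole space, since the span contains \<open>Vs 0\<close>.\<close>

lemma diagonal_span_trivial:
  fixes r :: nat
  defines "X \<equiv> \<lambda>n. F (Suc n) \<inter> G (n + r)"
  shows "subspace_sum scale UNIV X = {0} \<or> subspace_sum scale UNIV X = UNIV" (is "?S = _ \<or> _")
proof (rule irreducible)
  show S: "subspace ?S" by (rule subspace_subspace_sum)
  have X: "v \<in> X n \<Longrightarrow> v \<in> ?S" for v n by (rule subspace_sum_upper) auto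
  have zero: "0 \<in> ?S" by (rule subspace_0[OF S])
  have AX: "A v \<in> ?S" if v: "v \<in> X n" for n v
  proof (cases "n + r \<le> d")
    case True
    have "A v - scale (\<theta> (n + r)) v \<in> X (Suc n)"
      using A_shift_G[OF True, of v] A_F[of v "Suc n"] F_mono[of "Suc n" "Suc (Suc n)"] v
      by (auto simp: X_def intro!: subspace_diff subspace_scale)
    then have "(A v - scale (\<theta> (n + r)) v) + scale (\<theta> (n + r)) v \<in> ?S"
      by (intro subspace_add[OF S] subspace_scale[OF S] X[OF v]) (rule X)
    then show ?thesis by simp
  next
    case False
    then have "v = 0" using v G_beyond by (auto simp: X_def)
    then show ?thesis using zero endo.linear_0[OF lin_A] by simp
  qed
  have AsX: "Astar v \<in> ?S" if v: "v \<in> X n" for n v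
  proof (cases "n \<le> d")
    case True
    have *: "Astar v - scale (\<theta>s n) v \<in> ?S"
    proof (cases n)
      case 0
      then show ?thesis using Astar_shift_F[OF True, of v] v F_0 zero by (simp add: X_def)
    next
      case (Suc k)
      then have "Astar v - scale (\<theta>s n) v \<in> X k"
        using Astar_shift_F[OF True, of v] Astar_G[of v "n + r"] G_antimono[of "k + r" "n + r"] v
        by (auto simp: X_def intro!: subspace_diff subspace_scale)
      then show ?thesis by (rule X)
    qed
    have "(Astar v - scale (\<theta>s n) v) + scale (\<theta>s n) v \<in> ?S"
      by (intro subspace_add[OF S] subspace_scale[OF S] X[OF v] *)
    then show ?thesis by simp
  next
    case False
    then have "v = 0" using v G_beyond by (auto simp: X_def)
    then show ?thesis using zero endo.linear_0[OF lin_Astar] by simp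
  qed
  show "A v \<in> ?S" if "v \<in> ?S" for v
    by (rule linear_subspace_sum_subset[OF lin_A S _ that]) (rule AX)
  show "Astar v \<in> ?S" if "v \<in> ?S" for v
    by (rule linear_subspace_sum_subset[OF lin_Astar S _ that]) (rule AsX)
qed

lemma F_inter_G: "F n \<inter> G n = {0}"
proof -
  let ?X = "\<lambda>n. F (Suc n) \<inter> G (n + 1)"
  have "subspace_sum scale UNIV ?X \<subseteq> G 1"
    using G_antimono[of 1 "n + 1" for n] by (intro subspace_sum_least subspace_G) fastforce
  moreover have "G 1 \<noteq> UNIV"
  proof
    assume G1: "G 1 = UNIV"
    have "V 0 \<subseteq> {0}"
    proof
      fix v assume v: "v \<in> V 0"
      have "v = 0"
      proof (rule eigenspace_disjoint_sum[OF lin_A, of "{1..d}" "\<theta> 0" \<theta> V])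
        show "\<theta> 0 \<notin> \<theta> ` {1..d}"
          using inj_onD[OF inj_\<theta>, of 0] by fastforce
        show "v \<in> subspace_sum scale {1..d} V" using G1 by (auto simp: G_def)
      qed (use v V_eigenspace in auto)
      then show "v \<in> {0}" by simp
    qed
    then show False
      using V_nonzero[of 0] V_eigenspace[of 0] subspace_0[OF subspace_eigenspace[OF lin_A]] by blast
  qed
  ultimately have "subspace_sum scale UNIV ?X = {0}"
    using diagonal_span_trivial[of 1] by auto
  then have X: "?X k \<subseteq> {0}" for k
    using subspace_sum_upper[of k UNIV _ ?X] by blast
  show ?thesis
    using X F_0 subspace_0[OF subspace_F] subspace_0[OF subspace_G] by (cases n) auto
qed

lemma U_span: "subspace_sum scale UNIV U = UNIV"
proof -
  have "Vs 0 \<subseteq> U 0"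
    using subspace_sum_upper[of 0 "{..0}" _ Vs] V_sum by (auto simp: U_def atMost_atLeast0)
  then have "U 0 \<noteq> {0}"
    using Vs_nonzero[of 0] Vs_eigenspace[of 0] subspace_0[OF subspace_eigenspace[OF lin_Astar]] by blast
  then have "subspace_sum scale UNIV U \<noteq> {0}"
    using subspace_sum_upper[of 0 UNIV _ U] subspace_0[OF subspace_U[of 0]] by blast
  moreover have "U = (\<lambda>n. F (Suc n) \<inter> G (n + 0))" by (simp add: U_eq fun_eq_iff)
  ultimately show ?thesis using diagonal_span_trivial[of 0] by auto
qed

text \<open>The summands before \<open>n\<close> lie in \<open>F n\<close>, the others in \<open>G n\<close>, and these two spaces meet only in
  \<open>0\<close>. So a vector of \<open>F n\<close> has no second part and a vector of \<open>G n\<close> no first part: both flags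
  are the partial sums of the \<open>U i\<close>.\<close>

lemma U_split:
  obtains s t where "s \<in> subspace_sum scale {..<n} U" "t \<in> subspace_sum scale {n..} U"
    "s \<in> F n" "t \<in> G n" "v = s + t"
proof -
  have "{..<n} \<union> {n..} = UNIV" by auto
  then obtain s t where st: "s \<in> subspace_sum scale {..<n} U" "t \<in> subspace_sum scale {n..} U" "v = s + t"
    using U_span subspace_sum_Un[of v "{..<n}" "{n..}" U] by (metis UNIV_I)
  have "subspace_sum scale {..<n} U \<subseteq> F n"
  proof (rule subspace_sum_least)
    show "U j \<subseteq> F n" if "j \<in> {..<n}" for j
      using that F_mono[of "Suc j" n] U_eq[of j] by auto
  qed simp
  moreover have "subspace_sum scale {n..} U \<subseteq> G n"
  proof (rule subspace_sum_least)
    show "U j \<subseteq> G n" if "j \<in> {n..}" for j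
      using that G_antimono[of n j] U_eq[of j] by auto
  qed simp
  ultimately show thesis using that st by blast
qed

lemma F_subset: "v \<in> F n \<Longrightarrow> v \<in> subspace_sum scale {..<n} U"
proof (rule U_split[of n v])
  fix s t assume v: "v \<in> F n"
    and st: "s \<in> subspace_sum scale {..<n} U" "s \<in> F n" "t \<in> G n" "v = s + t"
  have "t \<in> F n" using subspace_diff[OF subspace_F v st(2)] st by simp
  then have "t = 0" using F_inter_G[of n] st(3) by blast
  then show ?thesis using st by simp
qed

lemma G_subset: "v \<in> G n \<Longrightarrow> v \<in> subspace_sum scale {n..} U"
proof (rule U_split[of n v])
  fix s t assume v: "v \<in> G n"
    and st: "t \<in> subspace_sum scale {n..} U" "s \<in> F n" "t \<in> G n" "v = s + t"
  have "s \<in> G n" using subspace_diff[OF subspace_G v st(3)] st by simp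
  then have "s = 0" using F_inter_G[of n] st(2) by blast
  then show ?thesis using st by simp
qed

lemma U_beyond: "d < n \<Longrightarrow> U n = {0}"
  using G_beyond subspace_0[OF subspace_F] by (auto simp: U_eq)

lemma U_sum: "subspace_sum scale {..d} U = UNIV"
proof -
  have "U n \<subseteq> subspace_sum scale {..d} U" for n
    using U_beyond[of n] subspace_sum_upper[of n "{..d}" _ U] subspace_0[OF subspace_subspace_sum]
    by (cases "n \<le> d") auto
  then have "subspace_sum scale UNIV U \<subseteq> subspace_sum scale {..d} U"
    by (intro subspace_sum_least subspace_subspace_sum)
  then show ?thesis using U_span by auto
qed

text \<open>If \<open>U n\<close> were \<open>{0}\<close>, the partial sums \<open>F n\<close> and \<open>F (Suc n)\<close> would agree, and
  \<open>Vs n\<close> would lie in the sum of the preceding eigenspaces.\<close>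

lemma U_nonzero:
  assumes n: "n \<le> d"
  shows "U n \<noteq> {0}"
proof
  assume U0: "U n = {0}"
  have "Vs n \<subseteq> {0}"
  proof
    fix v assume v: "v \<in> Vs n"
    then have "v \<in> F (Suc n)" unfolding F_def by (intro subspace_sum_upper) auto
    then have "v \<in> subspace_sum scale {..<Suc n} U" by (rule F_subset)
    also have "\<dots> \<subseteq> F n"
    proof (rule subspace_sum_least)
      fix j assume j: "j \<in> {..<Suc n}"
      show "U j \<subseteq> F n"
      proof (cases "j = n")
        case True
        then show ?thesis using U0 subspace_0[OF subspace_F[of n]] by simp
      next
        case False
        then show ?thesis using j F_mono[of "Suc j" n] U_eq[of j] by auto
      qed
    qed simp
    finally have "v \<in> subspace_sum scale {..<n} Vs" by (simp add: F_def)
    moreover have "\<theta>s n \<notin> \<theta>s ` {..<n}" using inj_onD[OF inj_\<theta>s, of n] n by fastforce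
    ultimately have "v = 0"
      using v n Vs_eigenspace
      by (intro eigenspace_disjoint_sum[OF lin_Astar, of "{..<n}" "\<theta>s n" \<theta>s Vs]) auto
    then show "v \<in> {0}" by simp
  qed
  then show False
    using Vs_nonzero[OF n] Vs_eigenspace[OF n] subspace_0[OF subspace_eigenspace[OF lin_Astar]] by blast
qed

theorem split_decomposition: "decomposition scale d U"
  unfolding decomposition_def
proof (intro conjI allI impI)
  show "subspace_sum scale {..d} U = UNIV" by (rule U_sum)
  fix w i assume w: "(\<forall>i\<le>d. w i \<in> U i) \<and> (\<Sum>i\<le>d. w i) = 0"
  show "i \<le> d \<Longrightarrow> w i = 0"
  proof (induction i rule: less_induct)
    case (less i)
    have "(\<Sum>j\<le>d. w j) = (\<Sum>j\<in>{i..d}. w j)"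
      using less by (intro sum.mono_neutral_right) auto
    also have "\<dots> = w i + (\<Sum>j\<in>{Suc i..d}. w j)"
      using less.prems by (simp add: sum.atLeast_Suc_atMost)
    finally have eq: "w i = - (\<Sum>j\<in>{Suc i..d}. w j)" using w by (simp add: eq_neg_iff_add_eq_0)
    have "w i \<in> F (Suc i)" using w less.prems U_eq by blast
    moreover have "(\<Sum>j\<in>{Suc i..d}. w j) \<in> G (Suc i)"
    proof (intro subspace_sum)
      show "w j \<in> G (Suc i)" if "j \<in> {Suc i..d}" for j
        using that w U_eq[of j] G_antimono[of "Suc i" j] by auto
    qed (rule subspace_G)
    then have "w i \<in> G (Suc i)" unfolding eq by (rule subspace_neg[OF subspace_G])
    ultimately show "w i = 0" using F_inter_G by blast
  qed
qed (use U_nonzero in auto)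

text \<open>Since \<open>G n\<close> is also a tail sum of the \<open>U j\<close>, an operator that is scalar on each \<open>U j\<close> is
  triangular for the same flag as the operators that are scalar on each \<open>V j\<close>. It is this common
  flag that makes \<open>K\<close> comparable with \<open>A\<close> and \<open>H\<close>.\<close>

lemma U_scalars_shift_G:
  assumes f: "Vector_Spaces.linear scale scale f"
    and f_U: "\<And>j w. j \<le> d \<Longrightarrow> w \<in> U j \<Longrightarrow> f w = scale (c j) w"
    and n: "n \<le> d" and v: "v \<in> G n"
  shows "f v - scale (c n) v \<in> G (Suc n)"
proof (rule linear_subspace_sum_subset[OF linear_shift[OF f] _ _ G_subset[OF v]])
  fix j w assume j: "j \<in> {n..}" and w: "w \<in> U j"
  consider "j = n" | "n < j" "j \<le> d" | "d < j" using j by fastforce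
  then show "f w - scale (c n) w \<in> G (Suc n)"
  proof cases
    case 1
    then show ?thesis using f_U n w subspace_0[OF subspace_G] by simp
  next
    case 2
    then have "w \<in> G (Suc n)" using w U_eq[of j] G_antimono[of "Suc n" j] by auto
    then show ?thesis
      using f_U[OF 2(2) w] by (simp add: subspace_diff subspace_scale)
  next
    case 3
    then have "w = 0" using U_beyond w by auto
    then show ?thesis
      using endo.linear_0[OF f] subspace_0[OF subspace_G] by simp
  qed
qed simp

lemma shift_preserves_G:
  assumes f: "Vector_Spaces.linear scale scale f"
    and shift: "\<And>n v. n \<le> d \<Longrightarrow> v \<in> G n \<Longrightarrow> f v - scale (c n) v \<in> G (Suc n)"
    and v: "v \<in> G n"
  shows "f v \<in> G n"
proof (cases "n \<le> d")
  case True
  then have "f v - scale (c n) v \<in> G n" using shift[OF True v] G_antimono[of n "Suc n"] by auto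
  from subspace_add[OF subspace_G this subspace_scale[OF subspace_G v, of "c n"]]
  show ?thesis by simp
next
  case False
  then show ?thesis using v G_beyond endo.linear_0[OF f] by auto
qed

lemma A_shift_U:
  assumes "n \<le> d" "v \<in> U n"
  shows "A v - scale (\<theta> n) v \<in> U (Suc n)"
  using assms A_shift_G[of n v] A_F[of v "Suc n"] F_mono[of "Suc n" "Suc (Suc n)"]
  by (auto simp: U_eq intro!: subspace_diff subspace_scale)

lemma V_decomposes:
  assumes i: "i \<le> d"
  shows "V i \<inter> subspace_sum scale ({..d} - {i}) V = {0}"
    and "\<exists>u\<in>V i. v - u \<in> subspace_sum scale ({..d} - {i}) V"
proof -
  have V: "subspace (V i)"
    using V_eigenspace[OF i] subspace_eigenspace[OF lin_A] by simp
  have "\<theta> i \<notin> \<theta> ` ({..d} - {i})" using inj_\<theta> i by (auto simp: inj_on_def)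
  then have "v = 0" if "v \<in> V i" "v \<in> subspace_sum scale ({..d} - {i}) V" for v
    using that i V_eigenspace
    by (intro eigenspace_disjoint_sum[OF lin_A, of "{..d} - {i}" "\<theta> i" \<theta> V]) auto
  then show "V i \<inter> subspace_sum scale ({..d} - {i}) V = {0}"
    using subspace_0[OF V] subspace_0[OF subspace_subspace_sum] by blast
  have "{i} \<union> ({..d} - {i}) = {..d}" using i by auto
  then obtain x y where "x \<in> subspace_sum scale {i} V" "y \<in> subspace_sum scale ({..d} - {i}) V" "v = x + y"
    using V_sum subspace_sum_Un[of v "{i}" "{..d} - {i}" V] by (metis UNIV_I)
  then show "\<exists>u\<in>V i. v - u \<in> subspace_sum scale ({..d} - {i}) V"
    using span_eq_iff[THEN iffD2, OF V] by (intro bexI[of _ x]) (simp_all add: subspace_sum_def)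
qed

lemma H_map_on_V:
  assumes j: "j \<le> d" and v: "v \<in> V j"
  shows "H_map scale q d \<theta> V v = scale (t_coeff q \<theta> j) v"
proof -
  have V: "subspace (V i)" if "i \<le> d" for i
    using V_eigenspace[OF that] subspace_eigenspace[OF lin_A] by simp
  have "E_proj scale d V i v = (if i = j then v else 0)" if i: "i \<le> d" for i
    unfolding E_proj_def
  proof (rule proj_along_eq[OF V[OF i] subspace_subspace_sum V_decomposes(1)[OF i]])
    show "(if i = j then v else 0) \<in> V i" using v subspace_0[OF V[OF i]] by simp
    show "v - (if i = j then v else 0) \<in> subspace_sum scale ({..d} - {i}) V"
      using subspace_sum_upper[of j "{..d} - {i}" v V] v j subspace_0[OF subspace_subspace_sum] by auto
  qed
  then have "H_map scale q d \<theta> V v = (\<Sum>i\<le>d. if i = j then scale (t_coeff q \<theta> i) v else 0)"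
    unfolding H_map_def by (intro sum.cong) auto
  then show ?thesis using j by simp
qed

lemma linear_H_map: "Vector_Spaces.linear scale scale (H_map scale q d \<theta> V)"
proof -
  have "Vector_Spaces.linear scale scale (E_proj scale d V i)" if i: "i \<le> d" for i
    unfolding E_proj_def using V_eigenspace[OF i] subspace_eigenspace[OF lin_A] V_decomposes[OF i]
    by (intro linear_proj_along subspace_subspace_sum) simp_all
  then have "Vector_Spaces.linear scale scale (\<lambda>v. \<Sum>i\<le>d. scale (t_coeff q \<theta> i) (E_proj scale d V i v))"
    by (intro endo.linear_compose_sum ballI endo.linear_compose_scale_right) auto
  then show ?thesis by (simp add: H_map_def[abs_def])
qed

end

section \<open>Two solutions of a quadratic equation, conjugate under H\<close>

text \<open>The parameter \<open>a\<close> is absorbed: \<open>M\<close> is \<open>a K\<close>, \<open>N\<close> is its inverse, and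
  \<open>y n = a\<^sup>-\<^sup>1 q\<^sup>2\<^sup>n\<^sup>-\<^sup>d\<close>. The claim becomes \<open>H N H\<^sup>-\<^sup>1 = A - M\<close>, and the only property of the
  weights \<open>t\<close> that enters is the ratio of consecutive ones.\<close>

locale lusztig_setting = tridiagonal_pair scale d A Astar \<theta> \<theta>s V Vs
  for scale :: "'f::field \<Rightarrow> 'v::ab_group_add \<Rightarrow> 'v" and d A Astar \<theta> \<theta>s V Vs +
  fixes q :: 'f and y t :: "nat \<Rightarrow> 'f" and M N H :: "'v \<Rightarrow> 'v"
  assumes q: "q \<noteq> 0" "\<forall>n::nat. n > 0 \<longrightarrow> q ^ n \<noteq> 1"
    and y_nonzero: "y n \<noteq> 0" and y_Suc: "y (Suc n) = q\<^sup>2 * y n"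
    and \<theta>_eq: "n \<le> d \<Longrightarrow> \<theta> n = y n + inverse (y n)"
    and lin_M: "Vector_Spaces.linear scale scale M"
    and lin_N: "Vector_Spaces.linear scale scale N"
    and MN: "M (N v) = v" and NM: "N (M v) = v"
    and M_on_U: "n \<le> d \<Longrightarrow> v \<in> U n \<Longrightarrow> M v = scale (inverse (y n)) v"
    and lin_H: "Vector_Spaces.linear scale scale H"
    and H_on_V: "n \<le> d \<Longrightarrow> v \<in> V n \<Longrightarrow> H v = scale (t n) v"
    and t_Suc: "Suc n \<le> d \<Longrightarrow> t n = y n * y (Suc n) * t (Suc n)"
begin

interpretation endo: vector_space_pair scale scale ..

lemma linear_comp:
  "Vector_Spaces.linear scale scale f \<Longrightarrow> Vector_Spaces.linear scale scale g
    \<Longrightarrow> Vector_Spaces.linear scale scale (\<lambda>v. f (g v))"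
  using Vector_Spaces.linear_compose[of scale scale g scale f] by (simp add: o_def)

lemmas linear_rules = linear_ident lin_A lin_M lin_N lin_H
  linear_comp[OF lin_A] linear_comp[OF lin_M] linear_comp[OF lin_N] linear_comp[OF lin_H]
  endo.linear_compose_add endo.linear_compose_sub endo.linear_compose_scale_right

lemmas expand = endo.linear_add[OF lin_A] endo.linear_add[OF lin_M] endo.linear_add[OF lin_N]
  endo.linear_add[OF lin_H] endo.linear_diff[OF lin_A] endo.linear_diff[OF lin_M]
  endo.linear_diff[OF lin_N] endo.linear_diff[OF lin_H] endo.linear_scale[OF lin_A]
  endo.linear_scale[OF lin_M] endo.linear_scale[OF lin_N] endo.linear_scale[OF lin_H]
  scale_right_distrib scale_right_diff_distrib

lemma N_on_U:
  assumes "n \<le> d" "v \<in> U n"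
  shows "N v = scale (y n) v"
proof -
  have "v = scale (inverse (y n)) (N v)"
    using NM[of v] M_on_U[OF assms] by (simp add: endo.linear_scale[OF lin_N])
  then have "scale (y n) v = scale (y n) (scale (inverse (y n)) (N v))" by simp
  then show ?thesis using y_nonzero[of n] by simp
qed

lemma M_shift_G: "n \<le> d \<Longrightarrow> v \<in> G n \<Longrightarrow> M v - scale (inverse (y n)) v \<in> G (Suc n)"
  by (rule U_scalars_shift_G[OF lin_M M_on_U])

lemma N_shift_G: "n \<le> d \<Longrightarrow> v \<in> G n \<Longrightarrow> N v - scale (y n) v \<in> G (Suc n)"
  by (rule U_scalars_shift_G[OF lin_N N_on_U])

lemma H_shift_G: "n \<le> d \<Longrightarrow> v \<in> G n \<Longrightarrow> H v - scale (t n) v \<in> G (Suc n)"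
  by (rule V_scalars_shift_G[OF lin_H H_on_V])

lemma H_A_commute: "H (A v) = A (H v)"
proof (rule linear_eq_on_subspace_sum[of "\<lambda>v. H (A v)" "\<lambda>v. A (H v)" "{..d}" V])
  show "H (A w) = A (H w)" if "j \<in> {..d}" "w \<in> V j" for j w
    using that A_on_V[of j w] H_on_V[of j w] by (simp add: expand mult.commute)
qed (use V_sum in \<open>auto intro: linear_rules\<close>)

text \<open>On \<open>U n\<close> the operator \<open>A\<close> is \<open>\<theta> n\<close> plus a part mapping \<open>U n\<close> to \<open>U (Suc n)\<close>. As the
  eigenvalues of \<open>M\<close> form a geometric progression with ratio \<open>q\<^sup>-\<^sup>2\<close>, the \<open>q\<close>-commutator with
  \<open>M\<close> kills the second part, and \<open>\<theta> n = y n + inverse (y n)\<close> evaluates the first.\<close>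

lemma M_A_relation:
  "scale q (M (A v)) - scale (inverse q) (A (M v)) = scale (q - inverse q) (M (M v) + v)"
proof (rule linear_eq_on_subspace_sum[of "\<lambda>v. scale q (M (A v)) - scale (inverse q) (A (M v))"
      "\<lambda>v. scale (q - inverse q) (M (M v) + v)" "{..d}" U])
  fix n w assume "n \<in> {..d}" and w: "w \<in> U n"
  then have n: "n \<le> d" by simp
  define b where "b = inverse (y n)"
  define r where "r = A w - scale (\<theta> n) w"
  have r: "r \<in> U (Suc n)" unfolding r_def using A_shift_U n w .
  have Aw: "A w = scale (\<theta> n) w + r" by (simp add: r_def)
  have Mw: "M w = scale b w" unfolding b_def by (rule M_on_U[OF n w])
  have Mr: "scale q (M r) = scale (inverse q * b) r"
  proof (cases "Suc n \<le> d")
    case True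
    have "q * inverse (y (Suc n)) = inverse q * b"
      using q(1) by (simp add: y_Suc b_def power2_eq_square)
    then show ?thesis using M_on_U[OF True r] by simp
  next
    case False
    then have "r = 0" using r U_beyond[of "Suc n"] by auto
    then show ?thesis using endo.linear_0[OF lin_M] by simp
  qed
  have "scale q (M (A w)) - scale (inverse q) (A (M w))
      = scale (q * (\<theta> n * b)) w + scale q (M r) - scale (inverse q * b) (scale (\<theta> n) w + r)"
    by (simp add: Aw Mw expand)
  also have "\<dots> = scale (q * (\<theta> n * b) - inverse q * b * \<theta> n) w"
    unfolding Mr by (simp add: expand scale_left_diff_distrib)
  also have "q * (\<theta> n * b) - inverse q * b * \<theta> n = (q - inverse q) * (\<theta> n * b)"
    by (simp add: algebra_simps)
  also have "\<theta> n * b = b * b + 1"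
    using y_nonzero[of n] unfolding \<theta>_eq[OF n] b_def by (simp add: distrib_right)
  also have "scale ((q - inverse q) * (b * b + 1)) w = scale (q - inverse q) (M (M w) + w)"
    by (simp add: Mw expand distrib_left scale_left_distrib)
  finally show "scale q (M (A w)) - scale (inverse q) (A (M w)) = scale (q - inverse q) (M (M w) + w)" .
qed (use U_sum in \<open>auto intro!: linear_rules\<close>)

text \<open>Multiplying the relation between \<open>M\<close> and \<open>A\<close> by \<open>N\<close> on both sides gives an equation
  for \<open>N\<close> with coefficients in \<open>A\<close>.\<close>

lemma A_N_relation:
  "scale q (A (N v)) - scale (inverse q) (N (A v)) = scale (q - inverse q) (N (N v) + v)"
proof -
  have "N (scale q (M (A (N v))) - scale (inverse q) (A (M (N v))))
      = N (scale (q - inverse q) (M (M (N v)) + N v))"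
    by (simp add: M_A_relation)
  then show ?thesis by (simp add: expand MN NM add.commute)
qed

text \<open>The operator that \<open>H N H\<^sup>-\<^sup>1\<close> turns out to be. It satisfies the same quadratic equation as \<open>N\<close>.\<close>

definition N' :: "'v \<Rightarrow> 'v" where "N' v = A v - M v"

lemma lin_N': "Vector_Spaces.linear scale scale N'"
  unfolding N'_def[abs_def] by (intro linear_rules)

lemma A_N'_relation:
  "scale q (A (N' v)) - scale (inverse q) (N' (A v)) = scale (q - inverse q) (N' (N' v) + v)"
proof -
  have "scale q (M (A v)) = scale (inverse q) (A (M v)) + scale (q - inverse q) (M (M v) + v)"
    using M_A_relation[of v] by (simp add: algebra_simps)
  then show ?thesis
    unfolding N'_def by (simp add: expand scale_left_diff_distrib algebra_simps)
qed

text \<open>The defect of the intertwining property. Writing it in this form avoids the inverse of \<open>H\<close>.\<close>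

definition D :: "'v \<Rightarrow> 'v" where "D v = H (N v) - N' (H v)"

lemma lin_D: "Vector_Spaces.linear scale scale D"
  unfolding D_def[abs_def] by (intro linear_rules lin_N' linear_comp[OF lin_N'])

text \<open>The difference of the two quadratic equations, using that \<open>H\<close> commutes with \<open>A\<close>; the
  quadratic terms telescope, and what remains is linear in \<open>D\<close>.\<close>

lemma A_D_relation:
  "scale q (A (D v)) - scale (inverse q) (D (A v)) = scale (q - inverse q) (D (N v) + N' (D v))"
proof -
  have 1: "scale q (A (H (N v))) - scale (inverse q) (H (N (A v))) = scale (q - inverse q) (H (N (N v)) + H v)"
    using arg_cong[OF A_N_relation[of v], of H] by (simp add: expand H_A_commute)
  have 2: "scale q (A (N' (H v))) - scale (inverse q) (N' (H (A v)))
      = scale (q - inverse q) (N' (N' (H v)) + H v)"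
    using A_N'_relation[of "H v"] by (simp add: H_A_commute)
  have "scale q (A (D v)) - scale (inverse q) (D (A v))
      = (scale q (A (H (N v))) - scale (inverse q) (H (N (A v))))
      - (scale q (A (N' (H v))) - scale (inverse q) (N' (H (A v))))"
    by (simp add: D_def expand)
  also have "\<dots> = scale (q - inverse q) (D (N v) + N' (D v))"
    unfolding 1 2 by (simp add: D_def expand endo.linear_diff[OF lin_N'])
  finally show ?thesis .
qed

text \<open>The diagonal and the first off-diagonal block of \<open>D\<close> vanish. Here the uniqueness argument
  below has coefficient zero, and the particular weights of \<open>H\<close> are needed:
  if \<open>M v = inverse (y n) v + z\<close> then inverting \<open>M\<close> gives the off-diagonal part
  \<open>- y n * y (Suc n) * z\<close> of \<open>N v\<close>, and conjugation by \<open>H\<close> rescales it, by \<open>t_Suc\<close>, to the off-diagonal part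
  \<open>- z\<close> of \<open>A - M\<close>.\<close>

lemma D_second_step:
  assumes n: "n \<le> d" and v: "v \<in> V n"
  shows "D v \<in> G (Suc (Suc n))"
proof -
  have vG: "v \<in> G n" using V_subset_G[of n n] n v by auto
  define z where "z = M v - scale (inverse (y n)) v"
  have z: "z \<in> G (Suc n)" unfolding z_def by (rule M_shift_G[OF n vG])
  define z1 where "z1 = N z - scale (y (Suc n)) z"
  define z2 where "z2 = H z - scale (t (Suc n)) z"
  \<comment> \<open>For \<open>n = d\<close> there is no next block and \<open>z = 0\<close>, so that no ratio of weights is needed.\<close>
  have z12: "z1 \<in> G (Suc (Suc n)) \<and> z2 \<in> G (Suc (Suc n))
      \<and> scale (y n * y (Suc n) * t (Suc n)) z = scale (t n) z"
  proof (cases "Suc n \<le> d")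
    case True
    then show ?thesis
      unfolding z1_def z2_def using N_shift_G[OF True z] H_shift_G[OF True z] t_Suc[OF True] by simp
  next
    case False
    then have "z = 0" using z G_beyond by auto
    then show ?thesis
      using subspace_0[OF subspace_G] endo.linear_0[OF lin_N] endo.linear_0[OF lin_H]
      by (simp add: z1_def z2_def)
  qed
  have Mv: "M v = scale (inverse (y n)) v + z" by (simp add: z_def)
  have Nz: "N z = scale (y (Suc n)) z + z1" by (simp add: z1_def)
  have Hz: "H z = scale (t (Suc n)) z + z2" by (simp add: z2_def)
  have "v = scale (inverse (y n)) (N v) + N z"
    using NM[of v] unfolding Mv by (simp add: expand)
  then have "scale (y n) v = scale (y n) (scale (inverse (y n)) (N v) + N z)" by simp
  then have Nv: "N v = scale (y n) v - scale (y n) (N z)"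
    using y_nonzero[of n] by (simp add: expand)
  have Hv: "H v = scale (t n) v" by (rule H_on_V[OF n v])
  have N'Hv: "N' (H v) = scale (t n * y n) v - scale (t n) z"
    unfolding N'_def Hv expand Mv A_on_V[OF n v] \<theta>_eq[OF n]
    by (simp add: scale_left_distrib distrib_left algebra_simps)
  have HNv: "H (N v) = scale (t n * y n) v - scale (y n * y (Suc n) * t (Suc n)) z
      - scale (y n * y (Suc n)) z2 - scale (y n) (H z1)"
    unfolding Nv Nz expand Hv Hz by (simp add: algebra_simps)
  have "D v = - scale (y n * y (Suc n)) z2 - scale (y n) (H z1)"
    unfolding D_def HNv N'Hv conjunct2[OF conjunct2[OF z12]] by simp
  also have "\<dots> \<in> G (Suc (Suc n))"
    using z12 shift_preserves_G[OF lin_H H_shift_G]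
    by (intro subspace_diff subspace_neg subspace_scale subspace_G) auto
  finally show ?thesis .
qed

lemma y_add: "y (n + m) = q ^ (2 * m) * y n"
  by (induction m) (simp_all add: y_Suc power_add power2_eq_square)

text \<open>The scalar is \<open>(inverse q * y p - q * y n) * (1 - inverse (y p * y n))\<close>. The first factor vanishes
  only for \<open>m = 1\<close>, and the second one only if \<open>\<theta> p = \<theta> n\<close>.\<close>

lemma coefficient_nonzero:
  assumes p: "p = n + m" "p \<le> d" and m: "2 \<le> m"
  shows "q * \<theta> p - inverse q * \<theta> n - (q - inverse q) * (y n + y p) \<noteq> 0"
proof -
  have y: "y p \<noteq> 0" "y n \<noteq> 0" by (rule y_nonzero)+
  have "q * \<theta> p - inverse q * \<theta> n - (q - inverse q) * (y n + y p)
      = (inverse q * y p - q * y n) * (1 - inverse (y p * y n))"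
    using p y q(1) by (simp add: \<theta>_eq field_simps)
  moreover have "inverse q * y p \<noteq> q * y n"
  proof
    assume "inverse q * y p = q * y n"
    then have "y p = q\<^sup>2 * y n" using q(1) by (simp add: field_simps power2_eq_square)
    then have "q ^ (2 * m) = q\<^sup>2" using y by (simp add: p(1) y_add)
    moreover obtain k where k: "m = Suc k" "0 < k" using m by (cases m) auto
    moreover have "q ^ (2 * Suc k) = q\<^sup>2 * q ^ (2 * k)" by (simp add: power2_eq_square)
    ultimately have "q ^ (2 * k) = 1" using q(1) by simp
    then show False using q(2) k(2) by (metis mult_pos_pos zero_less_numeral)
  qed
  moreover have "y p * y n \<noteq> 1"
  proof
    assume "y p * y n = 1"
    then have "y n = inverse (y p)" using y(1) by (simp add: field_simps)
    then have "\<theta> p = \<theta> n" using p \<theta>_eq by simp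
    then show False using inj_onD[OF inj_\<theta>, of p n] p m by simp
  qed
  ultimately show ?thesis by (metis inverse_1 inverse_inverse_eq mult_eq_0_iff right_minus_eq)
qed

text \<open>Read modulo \<open>G (n + Suc m)\<close> on a vector of \<open>V n\<close>, the linear relation for \<open>D\<close> says that the first
  possibly nonzero block of \<open>D\<close> is killed by a nonzero scalar.\<close>

lemma D_step:
  assumes m: "2 \<le> m"
    and IH: "\<And>n v. n \<le> d \<Longrightarrow> v \<in> V n \<Longrightarrow> D v \<in> G (n + m)"
    and n: "n \<le> d" and v: "v \<in> V n"
  shows "D v \<in> G (n + Suc m)"
proof (cases "n + m \<le> d")
  case False
  then show ?thesis using IH[OF n v] G_beyond[of "n + m"] subspace_0[OF subspace_G] by simp
next
  case p: True
  define p where "p = n + m"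
  define c where "c = q * \<theta> p - inverse q * \<theta> n - (q - inverse q) * (y n + y p)"
  define w where "w = D v"
  have w: "w \<in> G p" unfolding w_def p_def by (rule IH[OF n v])
  have DG: "D x \<in> G (k + m)" if x: "x \<in> G k" for k x
  proof (rule linear_subspace_sum_subset[OF lin_D])
    show "x \<in> subspace_sum scale {k..d} V" using x by (simp add: G_def)
    show "D v' \<in> G (k + m)" if "j \<in> {k..d}" "v' \<in> V j" for j v'
      using IH[of j v'] G_antimono[of "k + m" "j + m"] that by auto
  qed simp
  have vG: "v \<in> G n" using V_subset_G[of n n] n v by auto
  define r1 where "r1 = A w - scale (\<theta> p) w"
  define r2 where "r2 = M w - scale (inverse (y p)) w"
  define r3 where "r3 = N v - scale (y n) v"
  have pd: "p \<le> d" using p by (simp add: p_def)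
  have r: "r1 \<in> G (Suc p)" "r2 \<in> G (Suc p)" "D r3 \<in> G (Suc p)"
    unfolding r1_def r2_def r3_def
    using A_shift_G[OF pd w] M_shift_G[OF pd w] DG[OF N_shift_G[OF n vG]] by (simp_all add: p_def)
  have "scale q (A w) - scale (inverse q) (D (A v)) = scale (q - inverse q) (D (N v) + N' w)"
    unfolding w_def by (rule A_D_relation)
  moreover have "A w = scale (\<theta> p) w + r1" "N' w = scale (y p) w + r1 - r2"
    using \<theta>_eq[OF pd] by (simp_all add: N'_def r1_def r2_def scale_left_distrib)
  moreover have "D (A v) = scale (\<theta> n) w" "D (N v) = scale (y n) w + D r3"
    unfolding r3_def w_def
    by (simp_all add: A_on_V[OF n v] endo.linear_scale[OF lin_D] endo.linear_diff[OF lin_D])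
  ultimately have "scale c w = scale (q - inverse q) (D r3 + r1 - r2) - scale q r1"
    unfolding c_def by (simp add: expand scale_left_distrib scale_left_diff_distrib algebra_simps)
  also have "\<dots> \<in> G (Suc p)"
    using r by (intro subspace_diff subspace_add subspace_scale subspace_G)
  finally have "scale (inverse c) (scale c w) \<in> G (Suc p)"
    by (rule subspace_scale[OF subspace_G])
  then show ?thesis
    using coefficient_nonzero[OF p_def pd m] by (simp add: c_def w_def p_def)
qed

theorem H_conjugates_N: "H (N v) = A (H v) - M (H v)"
proof -
  have step: "n \<le> d \<Longrightarrow> v \<in> V n \<Longrightarrow> D v \<in> G (n + Suc (Suc k))" for n v k
  proof (induction k arbitrary: n v)
    case 0
    then show ?case using D_second_step by simp
  next
    case (Suc k)
    then show ?case using D_step[of "Suc (Suc k)"] by simp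
  qed
  have "D v \<in> {0}"
  proof (rule linear_subspace_sum_subset[OF lin_D, of _ "{..d}" V])
    show "D w \<in> {0}" if "j \<in> {..d}" "w \<in> V j" for j w
      using step[of j w d] that G_beyond[of "j + Suc (Suc d)"] by simp
  qed (use V_sum in simp_all)
  then show ?thesis by (simp add: D_def N'_def)
qed

end

section \<open>The tridiagonal action forced by the defining relations\<close>

lemma power_int_eq_one:
  fixes q :: "'f::field"
  assumes "q \<noteq> 0" "\<forall>n::nat. n > 0 \<longrightarrow> q ^ n \<noteq> 1" "q powi k = 1"
  shows "k = 0"
proof (rule ccontr)
  assume "k \<noteq> 0"
  then have "nat \<bar>k\<bar> > 0" by simp
  moreover have "q ^ nat \<bar>k\<bar> = 1"
    using assms(3) by (cases "k \<ge> 0") (auto simp: power_int_def power_inverse)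
  ultimately show False using assms(2) by blast
qed

text \<open>The second factor is \<open>(\<theta> i - \<theta> (j - 1)) * (\<theta> i - \<theta> (j + 1))\<close>, with the closed
  formula for \<open>\<theta>\<close> read at all integers. For indices \<open>k, l\<close> different from each other,
  \<open>\<theta> k = \<theta> l\<close> means \<open>X k * X l = 1\<close>, a condition on \<open>k + l\<close> alone. So if \<open>\<theta> i\<close>, with
  \<open>i\<close> at distance at least two from \<open>j\<close>, were equal to the value at \<open>-1\<close> or \<open>d + 1\<close>, then two of the
  values at \<open>0, \<dots>, d\<close> would coincide.\<close>

lemma onsager_factor_nonzero:
  fixes q a :: "'f::field" and \<theta> :: "nat \<Rightarrow> 'f"
  assumes q: "q \<noteq> 0" "\<forall>n::nat. n > 0 \<longrightarrow> q ^ n \<noteq> 1" and a: "a \<noteq> 0"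
    and \<theta>: "\<forall>i\<le>d. \<theta> i = a * q powi (int d - 2 * int i) + inverse a * q powi (2 * int i - int d)"
    and inj: "inj_on \<theta> {..d}" and ij: "i \<le> d" "j \<le> d" "\<not> (i \<le> j + 1 \<and> j \<le> i + 1)"
  shows "(\<theta> i - \<theta> j) * ((inverse q * \<theta> i - q * \<theta> j) * (q * \<theta> i - inverse q * \<theta> j) + (q^2 - (inverse q)^2)^2) \<noteq> 0"
proof -
  define X where "X k = a * q powi (int d - 2 * k)" for k :: int
  define T where "T k = X k + inverse (X k)" for k
  have X0: "X k \<noteq> 0" for k using q a by (simp add: X_def)
  have \<theta>T: "\<theta> k = T (int k)" if "k \<le> d" for k
    using \<theta> that by (simp add: T_def X_def flip: power_int_minus)
  have X_shift: "X (k - 1) = q^2 * X k" "X (k + 1) = inverse (q^2) * X k" for k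
    using q(1) by (simp_all add: X_def power_int_diff power_int_add algebra_simps power2_eq_square field_simps)
  have X_mult: "X k * X l = a^2 * q powi (2 * int d - 2 * (k + l))" for k l
    using q(1) by (simp add: X_def power2_eq_square algebra_simps flip: power_int_add)
  have X_prod: "X k * X l = X k' * X l'" if "k + l = k' + l'" for k l k' l'
    unfolding X_mult that ..
  have X_inj: "k = l" if "X k = X l" for k l
  proof -
    have "q powi (2 * (l - k)) = q powi (int d - 2 * k) / q powi (int d - 2 * l)"
      using q(1) by (simp add: algebra_simps flip: power_int_diff)
    also have "\<dots> = 1" using that a q(1) by (simp add: X_def)
    finally show ?thesis using power_int_eq_one[OF q, of "2 * (l - k)"] by simp
  qed
  have T_diff: "T k - T l = (X k - X l) * (1 - inverse (X k * X l))" for k l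
    using X0[of k] X0[of l] by (simp add: T_def field_simps)
  have T_eq_iff: "T k = T l \<longleftrightarrow> k = l \<or> X k * X l = 1" for k l
  proof -
    have "T k = T l \<longleftrightarrow> T k - T l = 0" by simp
    also have "\<dots> \<longleftrightarrow> X k = X l \<or> X k * X l = 1"
      unfolding T_diff mult_eq_0_iff right_minus_eq by (metis inverse_1 inverse_inverse_eq)
    finally show ?thesis using X_inj by auto
  qed
  have no: "X (int k) * X (int l) \<noteq> 1" if "k \<le> d" "l \<le> d" "k \<noteq> l" for k l
    using T_eq_iff[of "int k" "int l"] inj_onD[OF inj, of k l] that \<theta>T by auto
  have i_near: "T (int i) \<noteq> T l" if l: "l = int j - 1 \<or> l = int j + 1" for l
  proof
    assume "T (int i) = T l"
    then have X1: "X (int i) * X l = 1" using T_eq_iff l ij(3) by auto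
    consider "0 \<le> l" "l \<le> int d" | "l = -1" | "l = int d + 1" using l ij(2) by linarith
    then show False
    proof cases
      case 1
      then have "nat l \<le> d" "i \<noteq> nat l" using l ij(3) by linarith+
      then show False using no[OF ij(1)] X1 1 by fastforce
    next
      case 2
      then have "int 0 + int (i - 1) = int i + l" using l ij(3) by linarith
      then have "X (int 0) * X (int (i - 1)) = 1" unfolding X1[symmetric] by (rule X_prod)
      moreover have "i - 1 \<le> d" "0 \<noteq> i - 1" using 2 l ij by linarith+
      ultimately show False using no[of 0 "i - 1"] by blast
    next
      case 3
      then have "int d + int (i + 1) = int i + l" by simp
      then have "X (int d) * X (int (i + 1)) = 1" unfolding X1[symmetric] by (rule X_prod)
      moreover have "i + 1 \<le> d" "d \<noteq> i + 1" using 3 l ij by linarith+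
      ultimately show False using no[of d "i + 1"] by blast
    qed
  qed
  define x where "x = X (int j)"
  define z where "z = T (int i)"
  have x: "x \<noteq> 0" using X0 by (simp add: x_def)
  have Tj: "T (int j) = x + inverse x" "T (int j - 1) = q^2 * x + inverse (q^2) * inverse x"
    "T (int j + 1) = inverse (q^2) * x + q^2 * inverse x"
    by (simp_all add: T_def X_shift x_def)
  have "(inverse q * z - q * (x + inverse x)) * (q * z - inverse q * (x + inverse x)) + (q^2 - (inverse q)^2)^2
      = (z - T (int j - 1)) * (z - T (int j + 1))"
    unfolding Tj using q(1) x by (simp add: field_simps power2_eq_square)
  moreover have "\<dots> \<noteq> 0" using i_near by (simp add: z_def)
  moreover have "\<theta> i \<noteq> \<theta> j" using inj_onD[OF inj, of i j] ij by auto
  ultimately show ?thesis using \<theta>T ij by (simp add: z_def Tj)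
qed

text \<open>On an eigenvector \<open>v\<close> of \<open>A\<close> the relation says that a cubic polynomial in \<open>A\<close> kills
  \<open>T v\<close>. So \<open>T v\<close> has components only in those eigenspaces of \<open>A\<close> whose eigenvalue is a root, and for
  \<open>c = \<theta> j\<close> a root among the \<open>\<theta> i\<close> is \<open>\<theta> j\<close> or one of its neighbours. The vectors \<open>u\<close> and \<open>x\<close>
  arise from \<open>T v\<close> by applying \<open>q A - q\<^sup>-\<^sup>1 c\<close> and then \<open>q\<^sup>-\<^sup>1 A - q c\<close>.\<close>

lemma (in vector_space) acts_tridiagonally_of_relation:
  fixes q a :: 'a and \<theta> :: "nat \<Rightarrow> 'a" and A T :: "'b \<Rightarrow> 'b"
  assumes q: "q \<noteq> 0" "\<forall>n::nat. n > 0 \<longrightarrow> q ^ n \<noteq> 1" and a: "a \<noteq> 0"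
    and \<theta>: "\<forall>i\<le>d. \<theta> i = a * q powi (int d - 2 * int i) + inverse a * q powi (2 * int i - int d)"
    and inj: "inj_on \<theta> {..d}"
    and A: "Vector_Spaces.linear scale scale A"
    and V: "\<And>i. i \<le> d \<Longrightarrow> V i = eigenspace scale A (\<theta> i)"
    and V_sum: "subspace_sum scale {..d} V = UNIV"
    and rel: "\<And>v c u x. A v = scale c v \<Longrightarrow> u = scale q (A (T v)) - scale (inverse q * c) (T v)
      \<Longrightarrow> x = scale (inverse q) (A u) - scale (q * c) u
      \<Longrightarrow> A x - scale c x + scale ((q^2 - (inverse q)^2)^2) (A (T v) - scale c (T v)) = 0"
  shows "acts_tridiagonally scale d T V"
  unfolding acts_tridiagonally_def
proof (intro allI impI subsetI, elim imageE)
  fix j y v assume j: "j \<le> d" and v: "v \<in> V j" and y: "y = T v"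
  interpret endo: vector_space_pair scale scale ..
  have sub: "subspace (V i)" if "i \<in> {..d}" for i
    using V that subspace_eigenspace[OF A] by simp
  obtain w where w: "\<forall>i\<in>{..d}. w i \<in> V i" and Tv: "T v = (\<Sum>i\<le>d. w i)"
    using subspace_sum_components[of "{..d}" V "T v"] sub V_sum by auto
  have Aw: "A (w i) = scale (\<theta> i) (w i)" if "i \<le> d" for i
    using w that V by (auto simp: eigenspace_def)
  have A_sum: "A (\<Sum>i\<le>d. scale (c i) (w i)) = (\<Sum>i\<le>d. scale (c i * \<theta> i) (w i))" for c
    unfolding endo.linear_sum[OF A] by (intro sum.cong) (auto simp: endo.linear_scale[OF A] Aw)
  have comb: "scale k (A (\<Sum>i\<le>d. scale (c i) (w i))) - scale l (\<Sum>i\<le>d. scale (c i) (w i))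
      = (\<Sum>i\<le>d. scale ((k * \<theta> i - l) * c i) (w i))" for k l c
    unfolding A_sum scale_sum_right sum_subtractf[symmetric]
    by (intro sum.cong) (simp_all add: algebra_simps scale_left_diff_distrib)
  define g where "g i = (\<theta> i - \<theta> j) * ((inverse q * \<theta> i - q * \<theta> j) * (q * \<theta> i - inverse q * \<theta> j)
    + (q^2 - (inverse q)^2)^2)" for i
  define u where "u = (\<Sum>i\<le>d. scale (q * \<theta> i - inverse q * \<theta> j) (w i))"
  define x where "x = (\<Sum>i\<le>d. scale ((inverse q * \<theta> i - q * \<theta> j) * (q * \<theta> i - inverse q * \<theta> j)) (w i))"
  have Tv1: "T v = (\<Sum>i\<le>d. scale 1 (w i))" by (simp add: Tv)
  have 1: "u = scale q (A (T v)) - scale (inverse q * \<theta> j) (T v)"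
    unfolding Tv1 comb u_def by simp
  have 2: "x = scale (inverse q) (A u) - scale (q * \<theta> j) u"
    unfolding u_def comb x_def ..
  have "A v = scale (\<theta> j) v" using v V[OF j] by (simp add: eigenspace_def)
  from rel[OF this 1 2]
  have "(scale 1 (A x) - scale (\<theta> j) x)
      + scale ((q^2 - (inverse q)^2)^2) (scale 1 (A (T v)) - scale (\<theta> j) (T v)) = 0" by simp
  moreover have "(\<Sum>i\<le>d. scale (g i) (w i)) = (scale 1 (A x) - scale (\<theta> j) x)
      + scale ((q^2 - (inverse q)^2)^2) (scale 1 (A (T v)) - scale (\<theta> j) (T v))"
    unfolding x_def Tv1 comb unfolding scale_sum_right sum.distrib[symmetric]
    by (intro sum.cong refl)
      (simp only: scale_scale scale_left_distrib[symmetric], simp add: g_def algebra_simps)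
  ultimately have "(\<Sum>i\<le>d. scale (g i) (w i)) = 0" by simp
  then have "scale (g i) (w i) = 0" if "i \<le> d" for i
    using w V that subspace_scale[OF subspace_eigenspace[OF A]]
    by (intro eigenvector_sum_zero[OF A _ inj, of "\<lambda>i. scale (g i) (w i)" i]) auto
  then have zero: "w i = 0" if "i \<le> d" "\<not> (i \<le> j + 1 \<and> j \<le> i + 1)" for i
    using onsager_factor_nonzero[OF q a \<theta> inj that(1) j that(2)] that(1) by (auto simp: g_def)
  have "w i \<in> subspace_sum scale {i. i \<le> d \<and> i \<le> j + 1 \<and> j \<le> i + 1} V" if "i \<le> d" for i
    using zero[OF that] w that subspace_0[OF subspace_subspace_sum]
      subspace_sum_upper[of i "{i. i \<le> d \<and> i \<le> j + 1 \<and> j \<le> i + 1}" "w i" V]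
    by (cases "i \<le> j + 1 \<and> j \<le> i + 1") auto
  then show "y \<in> subspace_sum scale {i. i \<le> d \<and> i \<le> j + 1 \<and> j \<le> i + 1} V"
    unfolding y Tv by (intro subspace_sum subspace_subspace_sum) auto
qed

section \<open>Modules over the q-Onsager algebra as pairs of operators\<close>

lemma onsager_ideal_ideal: "ideal (onsager_ideal q) free_alg_ring"
  unfolding onsager_ideal_def
  by (rule ring.genideal_ideal[OF ring_free_alg_ring]) (simp add: free_alg_ring_def)

lemma carrier_onsager_algebra: "carrier (onsager_algebra q) = range (oq_class q)"
  by (auto simp: onsager_algebra_def FactRing_def A_RCOSETS_def' oq_class_def free_alg_ring_def)

lemma oq_class_add:
  "oq_class q (x + y) = oq_class q x \<oplus>\<^bsub>onsager_algebra q\<^esub> oq_class q y"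
  using ring_hom_add[OF ideal.rcos_ring_hom[OF onsager_ideal_ideal[of q]], of x y]
  by (simp add: onsager_algebra_def oq_class_def free_alg_ring_def)

lemma oq_class_mult:
  "oq_class q (x * y) = oq_class q x \<otimes>\<^bsub>onsager_algebra q\<^esub> oq_class q y"
  using ring_hom_mult[OF ideal.rcos_ring_hom[OF onsager_ideal_ideal[of q]], of x y]
  by (simp add: onsager_algebra_def oq_class_def free_alg_ring_def)

lemma oq_class_ideal:
  assumes "x \<in> onsager_ideal q"
  shows "oq_class q x = oq_class q 0"
proof -
  interpret ideal "onsager_ideal q" free_alg_ring by (rule onsager_ideal_ideal)
  have "0 \<in> onsager_ideal q"
    using additive_subgroup.zero_closed[OF additive_subgroup_axioms] by (simp add: free_alg_ring_def)
  then show ?thesis using assms a_rcos_const by (simp add: oq_class_def)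
qed

context
  fixes q :: "'f::field" and scale :: "'f \<Rightarrow> 'v::ab_group_add \<Rightarrow> 'v"
    and act :: "'f free_alg set \<Rightarrow> 'v \<Rightarrow> 'v"
  assumes mod: "oq_module q scale act"
begin

interpretation vector_space scale using mod by (simp add: oq_module_def)
interpretation endo: vector_space_pair scale scale ..

text \<open>The action pulled back to the free algebra, where it can be computed on words.\<close>

definition rep :: "'f free_alg \<Rightarrow> 'v \<Rightarrow> 'v" where "rep x = act (oq_class q x)"

lemma linear_rep: "Vector_Spaces.linear scale scale (rep x)"
  and rep_add: "rep (x + y) v = rep x v + rep y v"
  and rep_mult: "rep (x * y) v = rep x (rep y v)"
  and rep_scalar: "rep (fa_scalar c) v = scale c v"
  using mod unfolding oq_module_def rep_def oq_class_add oq_class_mult carrier_onsager_algebra by blast+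

lemma rep_diff: "rep (x - y) v = rep x v - rep y v"
  using rep_add[of "x - y" y v] by simp

lemma rep_relator:
  assumes "x \<in> onsager_ideal q"
  shows "rep x v = 0"
proof -
  have "rep x v = rep (fa_scalar 0) v"
    using oq_class_ideal[OF assms] by (simp add: rep_def fa_scalar_def)
  then show ?thesis by (simp add: rep_scalar)
qed

text \<open>The first defining relation, with \<open>A\<close> replaced by \<open>c\<close> wherever it meets \<open>v\<close> directly. The
  iterated commutator then factors into \<open>A - c\<close> and two \<open>q\<close>-analogues of it.\<close>

lemma rep_relation_on_eigenvector:
  defines "A \<equiv> rep (fa_gen Gen_A)" and "T \<equiv> rep (fa_gen Gen_Astar)"
  assumes v: "A v = scale c v" and u: "u = scale q (A (T v)) - scale (inverse q * c) (T v)"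
    and x: "x = scale (inverse q) (A u) - scale (q * c) u"
  shows "A x - scale c x + scale ((q^2 - (inverse q)^2)^2) (A (T v) - scale c (T v)) = 0"
proof -
  have lin: "Vector_Spaces.linear scale scale A" "Vector_Spaces.linear scale scale T"
    by (simp_all add: A_def T_def linear_rep)
  note expand = endo.linear_diff[OF lin(1)] endo.linear_diff[OF lin(2)] endo.linear_scale[OF lin(1)]
    endo.linear_scale[OF lin(2)] scale_right_diff_distrib
  have "onsager_relator q (fa_gen Gen_A) (fa_gen Gen_Astar) \<in> onsager_ideal q"
    unfolding onsager_ideal_def
    using ring.genideal_self[OF ring_free_alg_ring,
        of "{onsager_relator q (fa_gen Gen_A) (fa_gen Gen_Astar), onsager_relator q (fa_gen Gen_Astar) (fa_gen Gen_A)}"]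
    by (simp add: free_alg_ring_def)
  from rep_relator[OF this, of v] show ?thesis
    unfolding onsager_relator_def fa_comm_def fa_qcomm_def rep_diff rep_mult rep_scalar
    unfolding A_def[symmetric] T_def[symmetric] v u x
    by (simp add: expand v algebra_simps)
qed

text \<open>This turns irreducibility as a module into irreducibility under the two operators.\<close>

lemma invariant_under_generators:
  assumes U: "subspace U" and A: "\<And>v. v \<in> U \<Longrightarrow> rep (fa_gen Gen_A) v \<in> U"
    and Astar: "\<And>v. v \<in> U \<Longrightarrow> rep (fa_gen Gen_Astar) v \<in> U" and v: "v \<in> U"
  shows "rep x v \<in> U"
proof -
  have gen: "rep (fa_gen g) v \<in> U" if "v \<in> U" for g v
    using A Astar that by (cases g) auto
  have word: "rep (Poly_Mapping.single (Word ws) c) v \<in> U" for ws c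
  proof (induction ws)
    case Nil
    have "Poly_Mapping.single (Word []) c = fa_scalar c"
      by (simp add: fa_scalar_def zero_onsager_word_def)
    then show ?case using subspace_scale[OF U v] by (simp add: rep_scalar)
  next
    case (Cons g ws)
    have "Poly_Mapping.single (Word (g # ws)) c = fa_gen g * Poly_Mapping.single (Word ws) c"
      by (simp add: fa_gen_def mult_single)
    then show ?case using gen[OF Cons] by (simp add: rep_mult)
  qed
  show ?thesis
  proof (induction x rule: update_induct)
    case const
    have "rep 0 v = scale 0 v" using rep_scalar[of 0 v] by (simp add: fa_scalar_def)
    then show ?case using subspace_0[OF U] by simp
  next
    case (update f w c)
    have "Poly_Mapping.update w c f = f + Poly_Mapping.single w c"
      using update.hyps
      by (intro poly_mapping_eqI) (auto simp: lookup_update lookup_add lookup_single in_keys_iff when_def)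
    moreover obtain ws where "w = Word ws" by (cases w)
    ultimately show ?case using subspace_add[OF U update.IH word] by (simp add: rep_add)
  qed
qed

end

section \<open>The four conjugation identities\<close>

lemma corresponding_map_cong:
  "(\<And>i. i \<le> d \<Longrightarrow> W i = W' i) \<Longrightarrow> corresponding_map scale q d W = corresponding_map scale q d W'"
  by (simp add: corresponding_map_def)

text \<open>The identity for \<open>K\<close>, in a form that keeps the ordering of the eigenspaces, \<open>a\<close> and the weights
  of \<open>H\<close> free. Inverting the ordering of the \<open>V i\<close> replaces \<open>a\<close> by \<open>inverse a\<close> and
  \<open>t n\<close> by \<open>t (d - n)\<close>; the rule for consecutive weights keeps its shape, and the result
  becomes the identity for \<open>B\<close>.\<close>

lemma (in tridiagonal_pair) conjugate_corresponding_map: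
  fixes q a :: 'f and t :: "nat \<Rightarrow> 'f" and H :: "'v \<Rightarrow> 'v"
  assumes q: "q \<noteq> 0" "\<forall>n::nat. n > 0 \<longrightarrow> q ^ n \<noteq> 1" and a: "a \<noteq> 0"
    and \<theta>: "\<And>i. i \<le> d \<Longrightarrow> \<theta> i = a * q powi (int d - 2 * int i) + inverse a * q powi (2 * int i - int d)"
    and H: "Vector_Spaces.linear scale scale H"
    and H_on_V: "\<And>n v. n \<le> d \<Longrightarrow> v \<in> V n \<Longrightarrow> H v = scale (t n) v"
    and t_nonzero: "\<And>n. n \<le> d \<Longrightarrow> t n \<noteq> 0"
    and t_Suc: "\<And>n. Suc n \<le> d \<Longrightarrow> t (Suc n) = a\<^sup>2 * q powi (2 * int d - 4 * int n - 2) * t n"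
    and K: "K = corresponding_map scale q d U"
  shows "H \<circ> inv_into UNIV K \<circ> inv_into UNIV H = (\<lambda>v. scale a (A v) - scale (a\<^sup>2) (K v))"
proof -
  interpret endo: vector_space_pair scale scale ..
  define c where "c i = q powi (int d - 2 * int i)" for i :: nat
  define y where "y n = inverse a * q powi (2 * int n - int d)" for n :: nat
  have K: "Vector_Spaces.linear scale scale K \<and> (\<forall>i\<le>d. \<forall>w\<in>U i. K w = scale (c i) w)"
    using theI'[OF corresponding_map_ex1[OF vector_space_axioms split_decomposition, of c]]
    unfolding K corresponding_map_def c_def .
  obtain L where L: "Vector_Spaces.linear scale scale L \<and> (\<forall>i\<le>d. \<forall>w\<in>U i. L w = scale (inverse (c i)) w)"
    using corresponding_map_ex1[OF vector_space_axioms split_decomposition, of "\<lambda>i. inverse (c i)"] by blast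
  have c0: "c i \<noteq> 0" for i using q by (simp add: c_def)
  have comp: "Vector_Spaces.linear scale scale (\<lambda>v. f (g v))"
    if "Vector_Spaces.linear scale scale f" "Vector_Spaces.linear scale scale g" for f g
    using Vector_Spaces.linear_compose[OF that(2,1)] by (simp add: o_def)
  have KL: "K (L v) = v" for v
  proof (rule linear_eq_on_subspace_sum[OF comp[OF conjunct1[OF K] conjunct1[OF L]] linear_ident])
    show "K (L w) = w" if "j \<in> {..d}" "w \<in> U j" for j w
      using K L c0 that by (simp add: endo.linear_scale[OF conjunct1[OF K]])
  qed (simp add: U_sum)
  have LK: "L (K v) = v" for v
  proof (rule linear_eq_on_subspace_sum[OF comp[OF conjunct1[OF L] conjunct1[OF K]] linear_ident])
    show "L (K w) = w" if "j \<in> {..d}" "w \<in> U j" for j w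
      using K L c0 that by (simp add: endo.linear_scale[OF conjunct1[OF L]])
  qed (simp add: U_sum)
  have inv_K: "inv_into UNIV K = L"
    by (rule inv_unique_comp) (simp_all add: fun_eq_iff KL LK)
  have surj: "v \<in> range H" for v
  proof -
    have "subspace (range H)"
      by (rule endo.linear_subspace_image[OF H subspace_UNIV])
    moreover have "V j \<subseteq> range H" if "j \<le> d" for j
    proof
      fix w assume w: "w \<in> V j"
      have "w = H (scale (inverse (t j)) w)"
        using H_on_V[OF that w] t_nonzero[OF that] by (simp add: endo.linear_scale[OF H])
      then show "w \<in> range H" by blast
    qed
    ultimately have "subspace_sum scale {..d} V \<subseteq> range H"
      by (intro subspace_sum_least) auto
    then show ?thesis using V_sum by auto
  qed
  have y_c: "y n = inverse a * inverse (c n)" for n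
    by (simp add: y_def c_def flip: power_int_minus)
  have y_Suc: "y (Suc n) = q\<^sup>2 * y n" for n
  proof -
    have "q powi (2 * int (Suc n) - int d) = q powi (2 + (2 * int n - int d))"
      by (simp add: algebra_simps)
    also have "\<dots> = q\<^sup>2 * q powi (2 * int n - int d)"
      using q(1) by (subst power_int_add) simp_all
    finally show ?thesis by (simp add: y_def)
  qed
  have yt: "t n = y n * y (Suc n) * t (Suc n)" if "Suc n \<le> d" for n
  proof -
    have "q powi (2 * int n - int d) * q powi (2 * int n - int d) * q\<^sup>2 * q powi (2 * int d - 4 * int n - 2)
        = q powi ((2 * int n - int d) + (2 * int n - int d) + 2 + (2 * int d - 4 * int n - 2))"
      by (simp only: power_int_add q(1) simp_thms) simp
    also have "\<dots> = 1" by simp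
    finally have *: "q powi (2 * int n - int d) * q powi (2 * int n - int d) * q\<^sup>2
        * q powi (2 * int d - 4 * int n - 2) = 1" .
    have "y n * y (Suc n) * t (Suc n)
        = (inverse a * inverse a * a\<^sup>2) * (q powi (2 * int n - int d) * q powi (2 * int n - int d) * q\<^sup>2
          * q powi (2 * int d - 4 * int n - 2)) * t n"
      unfolding y_Suc t_Suc[OF that] by (simp add: y_def mult_ac)
    moreover have "inverse a * inverse a * a\<^sup>2 = 1" using a by (simp add: field_simps power2_eq_square)
    ultimately show ?thesis unfolding * by simp
  qed
  interpret lusztig_setting scale d A Astar \<theta> \<theta>s V Vs q y t
    "\<lambda>v. scale a (K v)" "\<lambda>v. scale (inverse a) (L v)" H
  proof (intro lusztig_setting.intro lusztig_setting_axioms.intro tridiagonal_pair_axioms)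
    show "\<theta> n = y n + inverse (y n)" if "n \<le> d" for n
      using \<theta>[OF that] by (simp add: y_def add.commute flip: power_int_minus)
    show "scale a (K v) = scale (inverse (y n)) v" if "n \<le> d" "v \<in> U n" for n v
      using K that by (simp add: y_c)
    show "Vector_Spaces.linear scale scale (\<lambda>v. scale a (K v))"
      by (intro endo.linear_compose_scale_right conjunct1[OF K])
    show "Vector_Spaces.linear scale scale (\<lambda>v. scale (inverse a) (L v))"
      by (intro endo.linear_compose_scale_right conjunct1[OF L])
    show "scale a (K (scale (inverse a) (L v))) = v" "scale (inverse a) (L (scale a (K v))) = v" for v
      using a by (simp_all add: endo.linear_scale[OF conjunct1[OF K]] endo.linear_scale[OF conjunct1[OF L]] KL LK)
    show "y n \<noteq> 0" for n using q(1) a by (simp add: y_def)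
    show "q \<noteq> 0" "\<forall>n::nat. n > 0 \<longrightarrow> q ^ n \<noteq> 1" "Vector_Spaces.linear scale scale H"
      by (rule q H)+
    show "y (Suc n) = q\<^sup>2 * y n" for n by (rule y_Suc)
    show "H v = scale (t n) v" if "n \<le> d" "v \<in> V n" for n v using that by (rule H_on_V)
    show "t n = y n * y (Suc n) * t (Suc n)" if "Suc n \<le> d" for n using that by (rule yt)
  qed
  have HL: "H (L x) = scale a (A (H x)) - scale (a\<^sup>2) (K (H x))" for x
  proof -
    have "scale (inverse a) (H (L x)) = A (H x) - scale a (K (H x))"
      using H_conjugates_N[of x] by (simp add: endo.linear_scale[OF H])
    then have "scale a (scale (inverse a) (H (L x))) = scale a (A (H x) - scale a (K (H x)))" by simp
    then show ?thesis using a by (simp add: scale_right_diff_distrib power2_eq_square)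
  qed
  show ?thesis
    unfolding inv_K using HL f_inv_into_f[OF surj] by (simp add: fun_eq_iff)
qed

text \<open>With \<open>w = a q\<^sup>d\<^sup>-\<^sup>2\<^sup>n\<^sup>-\<^sup>2\<close> one has \<open>\<theta> n = q\<^sup>2 w + (q\<^sup>2 w)\<^sup>-\<^sup>1\<close> and \<open>\<theta> (n + 1) = w + w\<^sup>-\<^sup>1\<close>, both
  fractions in the definition simplify, and the outcome is the square of \<open>q w\<close>.\<close>

lemma t_pair_eq:
  fixes q a :: "'f::field" and \<theta> :: "nat \<Rightarrow> 'f"
  assumes q: "q \<noteq> 0" "\<forall>n::nat. n > 0 \<longrightarrow> q ^ n \<noteq> 1" and a: "a \<noteq> 0"
    and \<theta>: "\<forall>i\<le>d. \<theta> i = a * q powi (int d - 2 * int i) + inverse a * q powi (2 * int i - int d)"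
    and n: "Suc n \<le> d"
  shows "t_pair q \<theta> n (n + 1) = a\<^sup>2 * q powi (2 * int d - 4 * int n - 2)"
proof -
  define w where "w = a * q powi (int d - 2 * int (Suc n))"
  have w: "w \<noteq> 0" using q a by (simp add: w_def)
  have \<theta>1: "\<theta> (n + 1) = w + inverse w"
    using \<theta> n by (simp add: w_def flip: power_int_minus)
  have "a * q powi (int d - 2 * int n) = a * q powi (2 + (int d - 2 * int (Suc n)))" by simp
  also have "\<dots> = q\<^sup>2 * w" using q(1) by (subst power_int_add) (simp_all add: w_def)
  finally have "q\<^sup>2 * w = a * q powi (int d - 2 * int n)" ..
  then have \<theta>0: "\<theta> n = q\<^sup>2 * w + inverse (q\<^sup>2 * w)"
    using \<theta> n by (simp flip: power_int_minus)
  have q2: "q\<^sup>2 \<noteq> 1" "q ^ 4 \<noteq> 1" using q(2) by (metis zero_less_numeral)+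
  have 1: "q - inverse q \<noteq> 0" using q2(1) q(1) by (simp add: field_simps power2_eq_square)
  have 2: "q\<^sup>2 - (inverse q)\<^sup>2 \<noteq> 0"
  proof
    assume "q\<^sup>2 - (inverse q)\<^sup>2 = 0"
    then have "q\<^sup>2 * q\<^sup>2 = 1" using q(1) by (simp add: field_simps)
    then show False using q2(2) by (simp flip: power_add)
  qed
  have "\<theta> n - \<theta> (n + 1) = (q - inverse q) * (q * w - inverse (q * w))"
    unfolding \<theta>0 \<theta>1 using q(1) w by (simp add: field_simps power2_eq_square)
  moreover have "q * \<theta> n - inverse q * \<theta> (n + 1) = (q\<^sup>2 - (inverse q)\<^sup>2) * (q * w)"
    unfolding \<theta>0 \<theta>1 using q(1) w by (simp add: field_simps power2_eq_square)
  ultimately have "t_pair q \<theta> n (n + 1) = 1 + (q * w - inverse (q * w)) * (q * w)"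
    using 1 2 by (simp add: t_pair_def)
  also have "\<dots> = (q * w)\<^sup>2"
    using q(1) w by (simp add: left_diff_distrib power2_eq_square del: inverse_mult_distrib)
  also have "\<dots> = a\<^sup>2 * q powi (1 + 1 + (int d - 2 * int (Suc n)) + (int d - 2 * int (Suc n)))"
    by (simp only: power_int_add q(1) simp_thms) (simp add: w_def power2_eq_square)
  finally show ?thesis by (simp add: algebra_simps)
qed

lemma subspace_sum_eigenspaces:
  assumes vs: "vector_space scale" and diag: "diagonalizable scale T"
    and V: "\<And>c. c \<in> eigenvalues scale T \<Longrightarrow> \<exists>i\<le>d. V i = eigenspace scale T c"
  shows "subspace_sum scale {..d} V = UNIV"
proof -
  interpret vector_space scale by (rule vs)
  obtain S where S: "\<not> dependent S" "span S = UNIV" "\<forall>b\<in>S. \<exists>c. T b = scale c b"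
    using diag unfolding diagonalizable_def by blast
  have "S \<subseteq> (\<Union>i\<in>{..d}. V i)"
  proof
    fix b assume b: "b \<in> S"
    then obtain c where c: "T b = scale c b" using S(3) by blast
    have "b \<noteq> 0" using S(1) b dependent_zero by blast
    then have "c \<in> eigenvalues scale T" using c by (auto simp: eigenvalues_def)
    then obtain i where "i \<le> d" "V i = eigenspace scale T c" using V by blast
    then show "b \<in> (\<Union>i\<in>{..d}. V i)" using c by (auto simp: eigenspace_def)
  qed
  then have "span S \<subseteq> subspace_sum scale {..d} V"
    unfolding subspace_sum_def by (rule span_mono)
  then show ?thesis using S(2) by auto
qed

theorem proposition6p3:
  fixes q a :: "'f::field"
    and scale :: "'f \<Rightarrow> 'v::ab_group_add \<Rightarrow> 'v"
    and Basis :: "'v set"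
    and act :: "'f free_alg set \<Rightarrow> 'v \<Rightarrow> 'v"
    and A Astar H K B Kd Bd :: "'v \<Rightarrow> 'v"
    and d :: nat
    and \<theta> :: "nat \<Rightarrow> 'f"
    and V Vstar :: "nat \<Rightarrow> 'v set"
  assumes q_nonzero: "q \<noteq> 0"
    and q_not_root_of_unity: "\<forall>n::nat. n > 0 \<longrightarrow> q ^ n \<noteq> 1"
    and fin_dim: "finite_dimensional_vector_space scale Basis"
    and dim_ge_2: "vector_space.dim scale (UNIV :: 'v set) \<ge> 2"
    and irred: "irreducible_oq_module q scale act"
    and A_def: "A = act (oq_class q (fa_gen Gen_A))"
    and Astar_def: "Astar = act (oq_class q (fa_gen Gen_Astar))"
    and diag_A: "diagonalizable scale A"
    and diag_Astar: "diagonalizable scale Astar"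
    and d_ge_1: "d \<ge> 1"
    and a_nonzero: "a \<noteq> 0"
    and \<theta>_ordering: "bij_betw \<theta> {..d} (eigenvalues scale A)"
    and \<theta>_form: "\<forall>i\<le>d. \<theta> i = a * q powi (int d - 2 * int i) + inverse a * q powi (2 * int i - int d)"
    and V_def: "\<forall>i\<le>d. V i = eigenspace scale A (\<theta> i)"
    and Vstar_ordering: "bij_betw Vstar {..d} (eigenspace scale Astar ` eigenvalues scale Astar)"
    and Vstar_tridiagonal: "acts_tridiagonally scale d A Vstar"
    and H_def: "H = H_map scale q d \<theta> V"
    and K_def: "K = corresponding_map scale q d
      (\<lambda>i. subspace_sum scale {..i} Vstar \<inter> subspace_sum scale {i..d} V)"
    and B_def: "B = corresponding_map scale q d
      (\<lambda>i. subspace_sum scale {..i} Vstar \<inter> subspace_sum scale {..d - i} V)"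
    and Kd_def: "Kd = corresponding_map scale q d
      (\<lambda>i. subspace_sum scale {d - i..d} Vstar \<inter> subspace_sum scale {i..d} V)"
    and Bd_def: "Bd = corresponding_map scale q d
      (\<lambda>i. subspace_sum scale {d - i..d} Vstar \<inter> subspace_sum scale {..d - i} V)"
  shows "H \<circ> inv_into UNIV B \<circ> inv_into UNIV H
           = (\<lambda>v. scale (inverse a) (A v) - scale (inverse (a^2)) (B v))
     \<and> H \<circ> inv_into UNIV K \<circ> inv_into UNIV H
           = (\<lambda>v. scale a (A v) - scale (a^2) (K v))
     \<and> H \<circ> inv_into UNIV Bd \<circ> inv_into UNIV H
           = (\<lambda>v. scale (inverse a) (A v) - scale (inverse (a^2)) (Bd v))
     \<and> H \<circ> inv_into UNIV Kd \<circ> inv_into UNIV H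
           = (\<lambda>v. scale a (A v) - scale (a^2) (Kd v))"
proof -
  have mod: "oq_module q scale act" using irred by (simp add: irreducible_oq_module_def)
  interpret vector_space scale using mod by (simp add: oq_module_def)
  have A_rep: "A = rep q act (fa_gen Gen_A)" and Astar_rep: "Astar = rep q act (fa_gen Gen_Astar)"
    by (simp_all add: A_def Astar_def rep_def[OF mod])
  have lin: "Vector_Spaces.linear scale scale A" "Vector_Spaces.linear scale scale Astar"
    unfolding A_rep Astar_rep by (rule linear_rep[OF mod])+
  have inj: "inj_on \<theta> {..d}" using \<theta>_ordering by (rule bij_betw_imp_inj_on)
  have V_eig: "V i = eigenspace scale A (\<theta> i)" if "i \<le> d" for i using V_def that by blast
  have V_sum: "subspace_sum scale {..d} V = UNIV"
  proof (rule subspace_sum_eigenspaces[OF vector_space_axioms diag_A])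
    fix c assume "c \<in> eigenvalues scale A"
    then obtain i where "i \<le> d" "c = \<theta> i" using \<theta>_ordering by (auto simp: bij_betw_def)
    then show "\<exists>i\<le>d. V i = eigenspace scale A c" using V_eig by blast
  qed
  have V0: "V i \<noteq> {0}" if "i \<le> d" for i
  proof -
    have "\<theta> i \<in> eigenvalues scale A" using \<theta>_ordering that by (auto simp: bij_betw_def)
    then show ?thesis using V_eig[OF that] by (auto simp: eigenvalues_def eigenspace_def)
  qed
  have "\<forall>i\<in>{..d}. \<exists>c. c \<in> eigenvalues scale Astar \<and> Vstar i = eigenspace scale Astar c"
  proof
    fix i assume "i \<in> {..d}"
    then have "Vstar i \<in> eigenspace scale Astar ` eigenvalues scale Astar"
      using Vstar_ordering unfolding bij_betw_def by blast
    then show "\<exists>c. c \<in> eigenvalues scale Astar \<and> Vstar i = eigenspace scale Astar c" by blast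
  qed
  then obtain \<theta>s where \<theta>s: "\<And>i. i \<le> d \<Longrightarrow> \<theta>s i \<in> eigenvalues scale Astar"
      "\<And>i. i \<le> d \<Longrightarrow> Vstar i = eigenspace scale Astar (\<theta>s i)"
    by (metis atMost_iff)
  have inj_s: "inj_on \<theta>s {..d}"
    using bij_betw_imp_inj_on[OF Vstar_ordering] \<theta>s(2) by (simp add: inj_on_def)
  have Vs_sum: "subspace_sum scale {..d} Vstar = UNIV"
  proof (rule subspace_sum_eigenspaces[OF vector_space_axioms diag_Astar])
    fix c assume "c \<in> eigenvalues scale Astar"
    then have "eigenspace scale Astar c \<in> Vstar ` {..d}" using Vstar_ordering by (simp add: bij_betw_def)
    then show "\<exists>i\<le>d. Vstar i = eigenspace scale Astar c" by auto
  qed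
  have Vs0: "Vstar i \<noteq> {0}" if "i \<le> d" for i
    using \<theta>s[OF that] by (auto simp: eigenvalues_def eigenspace_def)
  have rel: "A x - scale c x + scale ((q^2 - (inverse q)^2)^2) (A (Astar v) - scale c (Astar v)) = 0"
    if "A v = scale c v" "u = scale q (A (Astar v)) - scale (inverse q * c) (Astar v)"
      "x = scale (inverse q) (A u) - scale (q * c) u" for v c u x
    using rep_relation_on_eigenvector[OF mod] that unfolding A_rep Astar_rep by blast
  have Astar_tri: "acts_tridiagonally scale d Astar V"
    by (rule acts_tridiagonally_of_relation[OF q_nonzero q_not_root_of_unity a_nonzero \<theta>_form inj lin(1) V_eig V_sum])
      (assumption | rule rel)+
  have irr: "U = {0} \<or> U = UNIV"
    if U: "subspace U" "\<And>v. v \<in> U \<Longrightarrow> A v \<in> U" "\<And>v. v \<in> U \<Longrightarrow> Astar v \<in> U" for U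
  proof -
    have "act x ` U \<subseteq> U" if "x \<in> carrier (onsager_algebra q)" for x
      using that invariant_under_generators[OF mod U(1) U(2)[unfolded A_rep] U(3)[unfolded Astar_rep]]
      by (auto simp: carrier_onsager_algebra rep_def[OF mod])
    then show ?thesis using irred U(1) unfolding irreducible_oq_module_def by blast
  qed
  have TP: "tridiagonal_pair scale d A Astar \<theta> \<theta>s V Vstar"
    by (intro tridiagonal_pair.intro tridiagonal_pair_axioms.intro vector_space_axioms lin V_eig \<theta>s(2)
        inj inj_s V0 Vs0 V_sum Vs_sum Astar_tri Vstar_tridiagonal irr)
  have TB: "tridiagonal_pair scale d A Astar (\<lambda>i. \<theta> (d - i)) \<theta>s (\<lambda>i. V (d - i)) Vstar"
    by (rule tridiagonal_pair.reverse_V[OF TP])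
  have TKd: "tridiagonal_pair scale d A Astar \<theta> (\<lambda>i. \<theta>s (d - i)) V (\<lambda>i. Vstar (d - i))"
    by (rule tridiagonal_pair.reverse_Vs[OF TP])
  have TBd: "tridiagonal_pair scale d A Astar (\<lambda>i. \<theta> (d - i)) (\<lambda>i. \<theta>s (d - i))
      (\<lambda>i. V (d - i)) (\<lambda>i. Vstar (d - i))"
    by (rule tridiagonal_pair.reverse_Vs[OF TB])
  define t where "t = t_coeff q \<theta>"
  have H_lin: "Vector_Spaces.linear scale scale H"
    unfolding H_def by (rule tridiagonal_pair.linear_H_map[OF TP])
  have H_on: "H v = scale (t n) v" if "n \<le> d" "v \<in> V n" for n v
    unfolding H_def t_def by (rule tridiagonal_pair.H_map_on_V[OF TP that])
  have t_Suc: "t (Suc n) = a\<^sup>2 * q powi (2 * int d - 4 * int n - 2) * t n" if "Suc n \<le> d" for n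
    using t_pair_eq[OF q_nonzero q_not_root_of_unity a_nonzero \<theta>_form that]
    by (simp add: t_def t_coeff_def)
  have t0: "t n \<noteq> 0" if "n \<le> d" for n
    using that
  proof (induction n)
    case 0
    then show ?case by (simp add: t_def t_coeff_def)
  next
    case (Suc n)
    then show ?case using t_Suc[of n] a_nonzero q_nonzero by simp
  qed
  have H_rev: "H v = scale (t (d - n)) v" if "n \<le> d" "v \<in> V (d - n)" for n v
    using H_on[of "d - n" v] that by simp
  have t_rev_Suc: "t (d - Suc n) = (inverse a)\<^sup>2 * q powi (2 * int d - 4 * int n - 2) * t (d - n)"
    if n: "Suc n \<le> d" for n
  proof -
    have e: "Suc (d - Suc n) = d - n" "2 * int d - 4 * int (d - Suc n) - 2 = - (2 * int d - 4 * int n - 2)"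
      using n by auto
    have "t (d - n) = a\<^sup>2 * inverse (q powi (2 * int d - 4 * int n - 2)) * t (d - Suc n)"
      using t_Suc[of "d - Suc n"] n unfolding e power_int_minus by simp
    then show ?thesis using a_nonzero q_nonzero by (simp add: field_simps power2_eq_square)
  qed
  have \<theta>: "\<theta> i = a * q powi (int d - 2 * int i) + inverse a * q powi (2 * int i - int d)" if "i \<le> d" for i
    using \<theta>_form that by blast
  have \<theta>_rev: "\<theta> (d - i) = inverse a * q powi (int d - 2 * int i)
      + inverse (inverse a) * q powi (2 * int i - int d)" if "i \<le> d" for i
    using \<theta>[of "d - i"] that by (simp add: of_nat_diff algebra_simps)
  note split = tridiagonal_pair.U_def[OF TP] tridiagonal_pair.U_def[OF TB]
    tridiagonal_pair.U_def[OF TKd] tridiagonal_pair.U_def[OF TBd]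
  note reindex = subspace_sum_reindex[of _ V "\<lambda>i. d - i"] subspace_sum_reindex[of _ Vstar "\<lambda>i. d - i"]
  have K: "K = corresponding_map scale q d (tridiagonal_pair.U scale d V Vstar)"
    unfolding K_def by (rule corresponding_map_cong) (simp add: split)
  have B: "B = corresponding_map scale q d (tridiagonal_pair.U scale d (\<lambda>i. V (d - i)) Vstar)"
    unfolding B_def by (rule corresponding_map_cong) (simp add: split reindex image_reflect)
  have Kd: "Kd = corresponding_map scale q d (tridiagonal_pair.U scale d V (\<lambda>i. Vstar (d - i)))"
    unfolding Kd_def
    by (rule corresponding_map_cong) (simp add: split reindex image_reflect)
  have Bd: "Bd = corresponding_map scale q d (tridiagonal_pair.U scale d (\<lambda>i. V (d - i)) (\<lambda>i. Vstar (d - i)))"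
    unfolding Bd_def by (rule corresponding_map_cong) (simp add: split reindex image_reflect)
  have a': "inverse a \<noteq> 0" using a_nonzero by simp
  have t0': "t (d - n) \<noteq> 0" if "n \<le> d" for n using t0 by simp
  note q = q_nonzero q_not_root_of_unity
  have forward: "H \<circ> inv_into UNIV K' \<circ> inv_into UNIV H = (\<lambda>v. scale a (A v) - scale (a\<^sup>2) (K' v))"
    if "tridiagonal_pair scale d A Astar \<theta> s V W"
      "K' = corresponding_map scale q d (tridiagonal_pair.U scale d V W)" for s W K'
    by (rule tridiagonal_pair.conjugate_corresponding_map
        [OF that(1) q a_nonzero \<theta> H_lin H_on t0 t_Suc that(2)])
  have backward: "H \<circ> inv_into UNIV B' \<circ> inv_into UNIV H
      = (\<lambda>v. scale (inverse a) (A v) - scale (inverse (a\<^sup>2)) (B' v))"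
    if "tridiagonal_pair scale d A Astar (\<lambda>i. \<theta> (d - i)) s (\<lambda>i. V (d - i)) W"
      "B' = corresponding_map scale q d (tridiagonal_pair.U scale d (\<lambda>i. V (d - i)) W)" for s W B'
    unfolding power_inverse[symmetric]
    by (rule tridiagonal_pair.conjugate_corresponding_map[where t = "\<lambda>n. t (d - n)",
        OF that(1) q a' \<theta>_rev H_lin H_rev t0' t_rev_Suc that(2)])
  show ?thesis
    using backward[OF TB B] forward[OF TP K] backward[OF TBd Bd] forward[OF TKd Kd] by blast
qed

end
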